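(* Let $c>0$, $k\in(0,1)$, $d\in\mathbb R$, let $\gamma:\mathbb R\to\mathbb R$ be $1$-periodic and $C^2$, and consider the system $$\ddot\psi=4\left(c^2\sin\psi+\varepsilon\gamma(t)z\right),\qquad \dot z=\varepsilon\gamma(t)\dot\psi.\qquad( * )$$ Suppose that $K(k)=\frac{cp}{2q}$ for some $p,q\in\mathbb N$ (positive integers), that $d<-8c^2(1-k^2)$, and that, with $T:=p$, there is an $\alpha_0\in\mathbb R$ such that $$\int_0^T\gamma(t+\alpha_0)\,\mathrm{cn}(2ct,k)\,dt=0\quad\text{and}\quad\int_0^T\dot\gamma(t+\alpha_0)\,\mathrm{cn}(2ct,k)\,dt\ne0 .$$ Then there is a $\delta>0$ such that for any $0\neq\varepsilon\in(-\delta,\delta)$ there are precisely two $p$-periodic solutions $(\psi_\pm,z_\pm)$ of $( * )$ on the level set $\frac{\dot\psi^2}{2}-4c^2(1-\cos\psi)-2z^2=d$ with $$(\psi_\pm(t),z_\pm(t))=\Big(\psi_{k,c}(t-\alpha_0),\ \pm\sqrt{-4c^2(1-k^2)-\tfrac d2}\Big)+O(\varepsilon),$$ one for each sign. Explicitly: for every sufficiently large $C>0$ there is $\delta>0$ such that for $0<|\varepsilon|<\delta$ and each choice of sign there is exactly one $p$-periodic solution on this level set whose distance, uniformly in $t$, from the displayed leading term is at most $C|\varepsilon|$.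
   Context: $K(k)$ is the complete elliptic integral of the first kind with modulus $k$; $\mathrm{sn}(\cdot,k)$, $\mathrm{cn}(\cdot,k)$ are Jacobi elliptic functions of modulus $k$. The function $$\psi_{k,c}(t)=\pi+2\arcsin\left(k\,\mathrm{sn}(2ct,k)\right)$$ is a periodic solution of $\ddot\psi=4c^2\sin\psi$ of period $\frac2cK(k)$. Along every solution of $( * )$ the quantity $\frac{\dot\psi^2}{2}-4c^2(1-\cos\psi)-2z^2$ is constant; the number $d$ is the fixed value of this first integral. A solution $(\psi,z)$ is $p$-periodic if both components are $p$-periodic. *)

theory Defs
  imports "HOL-Analysis.Analysis"
begin

text \<open>Throughout, \<open>k\<close> is the modulus (not the parameter \<open>m = k\<^sup>2\<close>). The interval integral is
  oriented, so \<open>elliptic_F k\<close> is odd.\<close>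

definition elliptic_F :: "real \<Rightarrow> real \<Rightarrow> real" where
  "elliptic_F k \<phi> = (LBINT \<theta>=0..\<phi>. 1 / sqrt (1 - k\<^sup>2 * (sin \<theta>)\<^sup>2))"

definition elliptic_K :: "real \<Rightarrow> real" where
  "elliptic_K k = elliptic_F k (pi / 2)"

text \<open>The amplitude is the inverse of \<open>elliptic_F k\<close>; for \<open>0 < k < 1\<close> it is well-defined on all of
  \<open>\<real>\<close>, see \<open>elliptic_F_ex1\<close> below.\<close>

definition jacobi_am :: "real \<Rightarrow> real \<Rightarrow> real" where
  "jacobi_am u k = (THE \<phi>. elliptic_F k \<phi> = u)"

definition jacobi_sn :: "real \<Rightarrow> real \<Rightarrow> real" where
  "jacobi_sn u k = sin (jacobi_am u k)"

definition jacobi_cn :: "real \<Rightarrow> real \<Rightarrow> real" where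
  "jacobi_cn u k = cos (jacobi_am u k)"

lemma elliptic_F_radicand:
  fixes k x :: real
  assumes "0 < k" "k < 1"
  shows "0 < 1 - k\<^sup>2 * (sin x)\<^sup>2"
proof -
  have "k\<^sup>2 * (sin x)\<^sup>2 \<le> k\<^sup>2 * 1"
    by (intro mult_left_mono) (auto simp: abs_square_le_1)
  also have "\<dots> < 1"
    using assms by (simp add: power_less_one_iff)
  finally show ?thesis by simp
qed

lemma elliptic_F_deriv:
  assumes "0 < k" "k < 1"
  shows "(elliptic_F k has_real_derivative 1 / sqrt (1 - k\<^sup>2 * (sin x)\<^sup>2)) (at x)"
proof -
  let ?f = "\<lambda>\<theta>. 1 / sqrt (1 - k\<^sup>2 * (sin \<theta>)\<^sup>2)"
  define a where "a = - \<bar>x\<bar> - 1"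
  define b where "b = \<bar>x\<bar> + 1"
  have cont: "continuous_on S ?f" for S
    by (intro continuous_intros ballI) (use elliptic_F_radicand[OF assms] in \<open>metis less_irrefl real_sqrt_eq_zero_cancel_iff\<close>)
  have "((\<lambda>u. LBINT y=ereal 0..ereal u. ?f y) has_vector_derivative ?f x) (at x within {a..b})"
    by (rule interval_integral_FTC2) (auto simp: a_def b_def cont)
  moreover have "(\<lambda>u. LBINT y=ereal 0..ereal u. ?f y) = elliptic_F k"
    by (simp add: elliptic_F_def fun_eq_iff flip: zero_ereal_def)
  moreover have "at x within {a..b} = at x"
    by (rule at_within_Icc_at) (auto simp: a_def b_def)
  ultimately show ?thesis
    by (simp add: has_real_derivative_iff_has_vector_derivative)
qed

lemma elliptic_F_ex1:
  assumes k: "0 < k" "k < 1"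
  shows "\<exists>!\<phi>. elliptic_F k \<phi> = u"
proof -
  have F0: "elliptic_F k 0 = 0"
    by (simp add: elliptic_F_def flip: zero_ereal_def)
  have ge1: "1 \<le> 1 / sqrt (1 - k\<^sup>2 * (sin x)\<^sup>2)" for x
    using elliptic_F_radicand[OF k, of x] by (simp add: field_simps)
  have incr: "y - x \<le> elliptic_F k y - elliptic_F k x" if xy: "x < y" for x y
  proof -
    obtain z where "elliptic_F k y - elliptic_F k x
        = (y - x) * (1 / sqrt (1 - k\<^sup>2 * (sin z)\<^sup>2))"
      using MVT2[OF xy, of "elliptic_F k" "\<lambda>x. 1 / sqrt (1 - k\<^sup>2 * (sin x)\<^sup>2)"]
        elliptic_F_deriv[OF k] by blast
    thus ?thesis
      using mult_left_mono[OF ge1[of z], of "y - x"] xy by simp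
  qed
  have inj: "x = y" if "elliptic_F k x = elliptic_F k y" for x y
    using incr[of x y] incr[of y x] that by linarith
  define v where "v = \<bar>u\<bar> + 1"
  have v: "- v < 0" "0 < v" "- v \<le> u" "u \<le> v"
    by (auto simp: v_def)
  have ends: "elliptic_F k (- v) \<le> u" "u \<le> elliptic_F k v"
    using incr[OF v(1)] incr[OF v(2)] v F0 by linarith+
  have "isCont (elliptic_F k) x" for x
    by (rule DERIV_isCont[OF elliptic_F_deriv[OF k]])
  hence "continuous_on {- v..v} (elliptic_F k)"
    by (simp add: continuous_at_imp_continuous_on)
  moreover have "- v \<le> v"
    using v by linarith
  ultimately obtain \<phi> where "elliptic_F k \<phi> = u"
    using IVT'[of "elliptic_F k" "- v" u v] ends by blast
  show ?thesis
  proof (rule ex1I)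
    show "elliptic_F k \<phi> = u" by fact
    show "y = \<phi>" if "elliptic_F k y = u" for y
      using that \<open>elliptic_F k \<phi> = u\<close> by (simp add: inj)
  qed
qed

definition psi_kc :: "real \<Rightarrow> real \<Rightarrow> real \<Rightarrow> real" where
  "psi_kc k c t = pi + 2 * arcsin (k * jacobi_sn (2 * c * t) k)"

definition C2_fun :: "(real \<Rightarrow> real) \<Rightarrow> bool" where
  "C2_fun \<gamma> \<longleftrightarrow> \<gamma> C1_differentiable_on UNIV \<and> deriv \<gamma> C1_differentiable_on UNIV"

definition is_solution ::
  "real \<Rightarrow> real \<Rightarrow> (real \<Rightarrow> real) \<Rightarrow> (real \<Rightarrow> real) \<Rightarrow> (real \<Rightarrow> real) \<Rightarrow> bool" where
  "is_solution c \<epsilon> \<gamma> \<psi> z \<longleftrightarrow>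
     (\<forall>t. \<psi> differentiable (at t)) \<and>
     (\<forall>t. (deriv \<psi> has_real_derivative 4 * (c\<^sup>2 * sin (\<psi> t) + \<epsilon> * \<gamma> t * z t)) (at t)) \<and>
     (\<forall>t. (z has_real_derivative \<epsilon> * \<gamma> t * deriv \<psi> t) (at t))"

definition on_level_set :: "real \<Rightarrow> real \<Rightarrow> (real \<Rightarrow> real) \<Rightarrow> (real \<Rightarrow> real) \<Rightarrow> bool" where
  "on_level_set c d \<psi> z \<longleftrightarrow>
     (\<forall>t. (deriv \<psi> t)\<^sup>2 / 2 - 4 * c\<^sup>2 * (1 - cos (\<psi> t)) - 2 * (z t)\<^sup>2 = d)"

text \<open>The leading term of the solution, with sign \<open>s \<in> {1, -1}\<close>.\<close>

definition leading_term ::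
  "real \<Rightarrow> real \<Rightarrow> real \<Rightarrow> real \<Rightarrow> real \<Rightarrow> real \<Rightarrow> real \<times> real" where
  "leading_term k c d \<alpha>\<^sub>0 s t =
     (psi_kc k c (t - \<alpha>\<^sub>0), s * sqrt (- 4 * c\<^sup>2 * (1 - k\<^sup>2) - d / 2))"

text \<open>The \<open>p\<close>-periodic solutions on the level set \<open>d\<close> staying within distance \<open>r\<close> of the leading
  term with sign \<open>s\<close>; \<open>dist\<close> is the Euclidean distance on \<open>\<real> \<times> \<real>\<close>.\<close>

definition near_solutions ::
  "real \<Rightarrow> real \<Rightarrow> real \<Rightarrow> (real \<Rightarrow> real) \<Rightarrow> nat \<Rightarrow> real \<Rightarrow> real \<Rightarrow> real \<Rightarrow> real
    \<Rightarrow> ((real \<Rightarrow> real) \<times> (real \<Rightarrow> real)) set" where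
  "near_solutions k c d \<gamma> p \<alpha>\<^sub>0 \<epsilon> s r =
     {(\<psi>, z). is_solution c \<epsilon> \<gamma> \<psi> z \<and> on_level_set c d \<psi> z \<and>
        periodic_fun_simple \<psi> (real p) \<and> periodic_fun_simple z (real p) \<and>
        (\<forall>t. dist (\<psi> t, z t) (leading_term k c d \<alpha>\<^sub>0 s t) \<le> r)}"

end

theory Submission
  imports Defs
begin

text \<open>Write \<open>\<psi> = \<psi>\<^sub>0 + \<epsilon> u\<close>, \<open>z = z\<^sub>0 + \<epsilon> w\<close>, where \<open>\<psi>\<^sub>0 t = psi_kc k c (t - \<alpha>\<^sub>0)\<close> and \<open>z\<^sub>0\<close> is the signed constant
  of the leading term, and let \<open>\<phi>\<close> be the derivative of \<open>\<psi>\<^sub>0\<close>. The level set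
  determines \<open>w\<close>, and \<open>u'' = 4 c\<^sup>2 cos \<psi>\<^sub>0 u + 4 \<gamma> z\<^sub>0 + O(\<epsilon>)\<close>. The periodic kernel of the linear part is
  spanned by \<open>\<phi>\<close>, since the explicit second solution \<open>\<phi>' + (1/4) (\<integral> \<phi>\<^sup>2) \<phi>\<close> is not periodic
  (Lyapunov--Schmidt). The first integral condition makes the equation solvable at order zero; the coefficient
  \<open>a\<close> of \<open>\<phi>\<close> in \<open>u\<close> is fixed by the solvability condition at order \<open>\<epsilon>\<close>, which at \<open>\<epsilon> = 0\<close> is affine
  in \<open>a\<close> with slope \<open>4 z\<^sub>0 \<integral> \<gamma> \<phi>'\<close>, nonzero by the second integral condition. Hence the periodic solutions
  \<open>\<epsilon>\<close>-close to the leading term are the fixed points of a map \<open>X \<mapsto> b + \<epsilon> F(\<epsilon>, X)\<close> on periodic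
  functions, with \<open>F\<close> locally bounded and Lipschitz uniformly in \<open>\<epsilon>\<close>, and this map is a contraction for
  small \<open>\<epsilon>\<close>.\<close>

section \<open>Primitives of periodic functions\<close>

text \<open>The oriented integral gives an antiderivative on the whole line, so shifts of the
  argument need no case distinction on the sign of \<open>t\<close>.\<close>

definition primitive :: "(real \<Rightarrow> real) \<Rightarrow> real \<Rightarrow> real" where
  "primitive f t = (LBINT s=0..t. f s)"

lemma primitive_0 [simp]: "primitive f 0 = 0"
  by (simp add: primitive_def flip: zero_ereal_def)

lemma primitive_has_derivative:
  assumes "continuous_on UNIV f"
  shows "(primitive f has_real_derivative f t) (at t within S)"
proof -
  \<comment> \<open>The fundamental theorem is applied within a compact interval; this one contains
    \<open>0\<close> and has \<open>t\<close> in its interior.\<close>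
  define a b where "a = - \<bar>t\<bar> - 1" and "b = \<bar>t\<bar> + 1"
  have "((\<lambda>u. LBINT y=ereal 0..ereal u. f y) has_vector_derivative f t) (at t within {a..b})"
    by (rule interval_integral_FTC2)
      (auto simp: a_def b_def intro: continuous_on_subset[OF assms])
  moreover have "(\<lambda>u. LBINT y=ereal 0..ereal u. f y) = primitive f"
    by (simp add: primitive_def fun_eq_iff flip: zero_ereal_def)
  moreover have "at t within {a..b} = at t"
    by (rule at_within_Icc_at) (auto simp: a_def b_def)
  ultimately have "(primitive f has_real_derivative f t) (at t)"
    by (simp add: has_real_derivative_iff_has_vector_derivative)
  thus ?thesis
    by (rule has_field_derivative_at_within)
qed

lemma continuous_on_of_derivative:
  assumes "\<And>t. (f has_real_derivative f' t) (at t)"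
  shows "continuous_on S f"
  using assms by (meson DERIV_isCont continuous_at_imp_continuous_on)

lemma continuous_on_primitive:
  "continuous_on UNIV f \<Longrightarrow> continuous_on S (primitive f)"
  by (rule continuous_on_of_derivative[OF primitive_has_derivative])

lemma eq_of_derivative_eq:
  fixes f g :: "real \<Rightarrow> real"
  assumes "\<And>t. (f has_real_derivative f' t) (at t)" "\<And>t. (g has_real_derivative f' t) (at t)"
  shows "f t - f s = g t - g s"
proof -
  have "((\<lambda>t. f t - g t) has_real_derivative 0) (at t)" for t
    using DERIV_diff[OF assms(1)[of t] assms(2)[of t]] by simp
  hence "f t - g t = f s - g s"
    using DERIV_isconst_all by blast
  thus ?thesis by simp
qed

lemma primitive_eq:
  assumes "\<And>t. (F has_real_derivative f t) (at t)" "continuous_on UNIV f"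
  shows "primitive f t = F t - F 0"
  using eq_of_derivative_eq[of "primitive f" f F t 0] primitive_has_derivative[OF assms(2)] assms(1)
  by simp

lemma primitive_add:
  assumes "continuous_on UNIV f" "continuous_on UNIV g"
  shows "primitive (\<lambda>s. f s + g s) t = primitive f t + primitive g t"
proof -
  have "((\<lambda>t. primitive f t + primitive g t) has_real_derivative f t + g t) (at t)" for t
    by (intro DERIV_add primitive_has_derivative assms)
  thus ?thesis
    by (subst primitive_eq) (auto intro!: continuous_intros assms)
qed

lemma primitive_cmult:
  assumes "continuous_on UNIV f"
  shows "primitive (\<lambda>s. c * f s) t = c * primitive f t"
proof -
  have "((\<lambda>t. c * primitive f t) has_real_derivative c * f t) (at t)" for t
    by (intro DERIV_cmult primitive_has_derivative assms)
  thus ?thesis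
    by (subst primitive_eq) (auto intro!: continuous_intros assms)
qed

lemma primitive_diff:
  assumes "continuous_on UNIV f" "continuous_on UNIV g"
  shows "primitive (\<lambda>s. f s - g s) t = primitive f t - primitive g t"
  using primitive_add[OF assms(1), of "\<lambda>s. (-1) * g s" t] primitive_cmult[OF assms(2), of "-1" t]
  by (simp add: assms continuous_on_minus)

lemma primitive_eq_integral:
  assumes "continuous_on UNIV f" "0 \<le> t"
  shows "primitive f t = integral {0..t} f"
proof -
  have "(f has_integral (primitive f t - primitive f 0)) {0..t}"
    by (rule fundamental_theorem_of_calculus)
      (auto simp: assms(2) simp flip: has_real_derivative_iff_has_vector_derivative
        intro!: primitive_has_derivative assms(1))
  thus ?thesis
    by (simp add: integral_unique)
qed

lemma primitive_shift:
  assumes "continuous_on UNIV f"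
  shows "primitive f (t + p) = primitive f p + primitive (\<lambda>s. f (s + p)) t"
proof -
  have "((\<lambda>t. primitive f (t + p)) has_real_derivative f (t + p)) (at t)" for t
    using DERIV_shift[of "primitive f" "f (t + p)" t p] primitive_has_derivative[OF assms]
    by blast
  moreover have "continuous_on UNIV (\<lambda>s. f (s + p))"
    by (rule continuous_on_compose2[OF assms]) (auto intro!: continuous_intros)
  ultimately show ?thesis
    by (subst (2) primitive_eq) auto
qed

text \<open>The integral from \<open>0\<close> to \<open>p + a\<close> is split once at
  \<open>a\<close> and once at \<open>p\<close>; by periodicity its piece from \<open>p\<close> to
  \<open>p + a\<close> equals the integral from \<open>0\<close> to \<open>a\<close>.\<close>

lemma primitive_periodic_shift:
  assumes "continuous_on UNIV f" "\<And>t. f (t + p) = f t"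
  shows "primitive (\<lambda>s. f (s + a)) p = primitive f p"
proof -
  have "primitive f (p + a) = primitive f a + primitive (\<lambda>s. f (s + a)) p"
    by (rule primitive_shift[OF assms(1)])
  moreover have "primitive f (a + p) = primitive f p + primitive f a"
    using primitive_shift[OF assms(1), of a p] assms(2) by simp
  ultimately show ?thesis
    by (simp add: add.commute)
qed

lemma primitive_of_periodic_derivative:
  assumes "\<And>t. (F has_real_derivative f t) (at t)" "continuous_on UNIV f" "\<And>t. F (t + p) = F t"
  shows "primitive f p = 0"
  using primitive_eq[OF assms(1,2), of p] assms(3)[of 0] by simp

lemma primitive_bound:
  assumes "continuous_on UNIV f" "\<And>s. s \<in> {0..p} \<Longrightarrow> \<bar>f s\<bar> \<le> B" "t \<in> {0..p}"
  shows "\<bar>primitive f t\<bar> \<le> p * B"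
proof -
  have "norm (primitive f t - primitive f 0) \<le> B * norm (t - 0)"
    by (rule field_differentiable_bound[where S = "{0..p}" and f' = f])
      (use assms in \<open>auto intro: primitive_has_derivative\<close>)
  also have "\<dots> \<le> B * p"
    using assms(2)[of 0] assms(3) by (intro mult_left_mono) auto
  finally show ?thesis by (simp add: mult.commute)
qed

section \<open>Bounds for periodic functions and their derivatives\<close>

lemma periodic_representative:
  fixes p :: real
  assumes "p > 0"
  obtains r where "r \<in> {0..p}" "\<And>f :: real \<Rightarrow> 'a. (\<And>s. f (s + p) = f s) \<Longrightarrow> f t = f r"
proof
  define n where "n = \<lfloor>t / p\<rfloor>"
  have "of_int n \<le> t / p" "t / p \<le> of_int n + 1"
    unfolding n_def by linarith+
  hence "of_int n * p \<le> t" "t \<le> (of_int n + 1) * p"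
    using assms by (simp_all only: pos_le_divide_eq pos_divide_le_eq)
  thus "t - of_int n * p \<in> {0..p}"
    by (auto simp: algebra_simps)
  fix f :: "real \<Rightarrow> 'a" assume "\<And>s. f (s + p) = f s"
  then interpret periodic_fun_simple f p
    by unfold_locales
  show "f t = f (t - of_int n * p)"
    by (rule minus_of_int[symmetric])
qed

lemma derivative_periodic:
  fixes f :: "real \<Rightarrow> real"
  assumes "\<And>t. (f has_real_derivative f' t) (at t)" "\<And>t. f (t + p) = f t"
  shows "f' (t + p) = f' t"
proof -
  have "((\<lambda>s. f (s + p)) has_real_derivative f' (t + p)) (at t)"
    using assms(1)[of "t + p"] by (simp add: DERIV_shift)
  hence "(f has_real_derivative f' (t + p)) (at t)"
    by (simp add: assms(2))
  with assms(1)[of t] show ?thesis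
    using DERIV_unique by blast
qed

lemma periodic_continuous_bounded:
  fixes f :: "real \<Rightarrow> real"
  assumes "p > 0" "continuous_on UNIV f" "\<And>t. f (t + p) = f t"
  obtains B where "B > 0" "\<And>t. \<bar>f t\<bar> \<le> B"
proof -
  have "bounded (f ` {0..p})"
    by (intro compact_imp_bounded compact_continuous_image continuous_on_subset[OF assms(2)]) auto
  then obtain B where B: "B > 0" "\<And>t. t \<in> {0..p} \<Longrightarrow> \<bar>f t\<bar> \<le> B"
    unfolding bounded_pos by auto
  have "\<bar>f t\<bar> \<le> B" for t
  proof -
    obtain r where "r \<in> {0..p}" "f t = f r"
      using periodic_representative[OF assms(1), of t, where 'a = real] assms(3) by metis
    thus ?thesis using B by simp
  qed
  with B(1) show ?thesis using that by blast
qed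

text \<open>Rolle's argument on the period ending at \<open>t\<close> yields a zero of
  \<open>f'\<close> within distance \<open>p\<close> of \<open>t\<close>; the bound on
  \<open>f''\<close> controls the growth of \<open>f'\<close> from there. This later turns a bound
  on positions into one on velocities.\<close>

lemma periodic_derivative_bound:
  fixes f f' f'' :: "real \<Rightarrow> real"
  assumes "p > 0" "\<And>t. (f has_real_derivative f' t) (at t)"
    "\<And>t. (f' has_real_derivative f'' t) (at t)" "\<And>t. f (t + p) = f t" "\<And>t. \<bar>f'' t\<bar> \<le> B"
  shows "\<bar>f' t\<bar> \<le> p * B"
proof -
  obtain r where r: "t - p < r" "r < t" "f' r = 0"
  proof -
    have "\<exists>z. t - p < z \<and> z < t \<and> f t - f (t - p) = (t - (t - p)) * f' z"
      by (rule MVT2) (use assms in auto)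
    moreover have "f (t - p) = f t"
      using assms(4)[of "t - p"] by simp
    ultimately show ?thesis using that \<open>p > 0\<close> by auto
  qed
  obtain z where "f' t - f' r = (t - r) * f'' z"
    using MVT2[OF r(2), of f' f''] assms(3) by blast
  hence "\<bar>f' t\<bar> = (t - r) * \<bar>f'' z\<bar>"
    using r by (simp add: abs_mult)
  also have "\<dots> \<le> p * B"
    using r assms(5)[of z] by (intro mult_mono) auto
  finally show ?thesis .
qed

section \<open>Locally Lipschitz operators, uniformly in a small parameter\<close>

text \<open>One constant \<open>L\<close> serves as bound and as Lipschitz constant. An arbitrary
  uniform bound \<open>D\<close> on the difference replaces the supremum norm. The point
  \<open>t\<close> stays in \<open>{0..p}\<close> because primitives may grow without bound along
  the line.\<close>

definition tame_bound ::
  "real \<Rightarrow> (real \<Rightarrow> (real \<Rightarrow> 'b::real_normed_vector) \<Rightarrow> real \<Rightarrow> real) \<Rightarrow> real \<Rightarrow> real \<Rightarrow> bool" where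
  "tame_bound p \<Phi> R L \<longleftrightarrow> 0 \<le> L \<and>
     (\<forall>\<epsilon> X Y D t. \<bar>\<epsilon>\<bar> \<le> 1 \<longrightarrow> continuous_on UNIV X \<longrightarrow> continuous_on UNIV Y \<longrightarrow>
        (\<forall>t. norm (X t) \<le> R) \<longrightarrow> (\<forall>t. norm (Y t) \<le> R) \<longrightarrow> (\<forall>t. norm (X t - Y t) \<le> D) \<longrightarrow> t \<in> {0..p}
        \<longrightarrow> \<bar>\<Phi> \<epsilon> X t\<bar> \<le> L \<and> \<bar>\<Phi> \<epsilon> X t - \<Phi> \<epsilon> Y t\<bar> \<le> L * D)"

text \<open>The class is closed under arithmetic, primitives and evaluation at \<open>p\<close>, so
  the estimates for the perturbation operators follow from the way these are built.\<close>

definition tame :: "real \<Rightarrow> (real \<Rightarrow> (real \<Rightarrow> 'b::real_normed_vector) \<Rightarrow> real \<Rightarrow> real) \<Rightarrow> bool" where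
  "tame p \<Phi> \<longleftrightarrow>
     (\<forall>\<epsilon> X. continuous_on UNIV X \<longrightarrow> continuous_on UNIV (\<Phi> \<epsilon> X)) \<and> (\<forall>R. \<exists>L. tame_bound p \<Phi> R L)"

lemma tame_boundI:
  fixes \<Phi> :: "real \<Rightarrow> (real \<Rightarrow> 'b::real_normed_vector) \<Rightarrow> real \<Rightarrow> real"
  assumes "0 \<le> L"
    and "\<And>\<epsilon> X Y D t. \<bar>\<epsilon>\<bar> \<le> 1 \<Longrightarrow> continuous_on UNIV X \<Longrightarrow> continuous_on UNIV Y \<Longrightarrow>
        \<forall>t. norm (X t) \<le> R \<Longrightarrow> \<forall>t. norm (Y t) \<le> R \<Longrightarrow> \<forall>t. norm (X t - Y t) \<le> D \<Longrightarrow> 0 \<le> D \<Longrightarrow>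
        t \<in> {0..p} \<Longrightarrow> \<bar>\<Phi> \<epsilon> X t\<bar> \<le> L \<and> \<bar>\<Phi> \<epsilon> X t - \<Phi> \<epsilon> Y t\<bar> \<le> L * D"
  shows "tame_bound p \<Phi> R L"
  unfolding tame_bound_def
proof (intro conjI allI impI assms(1))
  fix \<epsilon> D t :: real and X Y :: "real \<Rightarrow> 'b"
  assume h: "\<bar>\<epsilon>\<bar> \<le> 1" "continuous_on UNIV X" "continuous_on UNIV Y" "\<forall>t. norm (X t) \<le> R"
    "\<forall>t. norm (Y t) \<le> R" "\<forall>t. norm (X t - Y t) \<le> D" "t \<in> {0..p}"
  have "0 \<le> D"
    using h(6) norm_ge_zero order_trans by blast
  thus "\<bar>\<Phi> \<epsilon> X t\<bar> \<le> L" "\<bar>\<Phi> \<epsilon> X t - \<Phi> \<epsilon> Y t\<bar> \<le> L * D"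
    using assms(2)[OF h(1-6) _ h(7)] by auto
qed

lemma tame_boundD:
  assumes "tame_bound p \<Phi> R L" "\<bar>\<epsilon>\<bar> \<le> 1" "continuous_on UNIV X" "continuous_on UNIV Y"
    "\<forall>t. norm (X t) \<le> R" "\<forall>t. norm (Y t) \<le> R" "\<forall>t. norm (X t - Y t) \<le> D" "t \<in> {0..p}"
  shows "\<bar>\<Phi> \<epsilon> X t\<bar> \<le> L" "\<bar>\<Phi> \<epsilon> Y t\<bar> \<le> L" "\<bar>\<Phi> \<epsilon> X t - \<Phi> \<epsilon> Y t\<bar> \<le> L * D"
proof -
  have "\<forall>t. norm (Y t - X t) \<le> D"
    using assms(7) by (simp add: norm_minus_commute)
  thus "\<bar>\<Phi> \<epsilon> X t\<bar> \<le> L" "\<bar>\<Phi> \<epsilon> Y t\<bar> \<le> L" "\<bar>\<Phi> \<epsilon> X t - \<Phi> \<epsilon> Y t\<bar> \<le> L * D"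
    using assms unfolding tame_bound_def by blast+
qed

lemma tame_continuous:
  "tame p \<Phi> \<Longrightarrow> continuous_on UNIV X \<Longrightarrow> continuous_on UNIV (\<Phi> \<epsilon> X)"
  unfolding tame_def by blast

lemma tameE:
  assumes "tame p \<Phi>"
  obtains L where "0 \<le> L" "tame_bound p \<Phi> R L"
  using assms unfolding tame_def tame_bound_def by metis

lemma tame_fun:
  assumes "continuous_on UNIV f"
  shows "tame p (\<lambda>\<epsilon> X. f)"
proof -
  have "bounded (f ` {0..p})"
    by (intro compact_imp_bounded compact_continuous_image continuous_on_subset[OF assms]) auto
  then obtain B where "B > 0" "\<And>t. t \<in> {0..p} \<Longrightarrow> \<bar>f t\<bar> \<le> B"
    unfolding bounded_pos by auto
  hence "tame_bound p (\<lambda>\<epsilon> X. f) R B" for R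
    by (intro tame_boundI) auto
  thus ?thesis
    using assms unfolding tame_def by blast
qed

lemma tame_parameter: "tame p (\<lambda>\<epsilon> X t. \<epsilon>)"
proof -
  have "tame_bound p (\<lambda>\<epsilon> X t. \<epsilon>) R 1" for R
    by (rule tame_boundI) auto
  thus ?thesis
    unfolding tame_def by auto
qed

lemma tame_component:
  fixes f :: "'b::real_normed_vector \<Rightarrow> real"
  assumes "bounded_linear f" "\<And>x. \<bar>f x\<bar> \<le> norm x"
  shows "tame p (\<lambda>\<epsilon> X t. f (X t))"
  unfolding tame_def
proof (intro conjI allI impI exI)
  show "continuous_on UNIV (\<lambda>t. f (X t))" if "continuous_on UNIV X" for X
    by (rule bounded_linear.continuous_on[OF assms(1) that])
  fix R
  \<comment> \<open>The constant dominates both the bound \<open>R\<close> and the Lipschitz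
    constant \<open>1\<close> of \<open>f\<close>.\<close>
  show "tame_bound p (\<lambda>\<epsilon> X t. f (X t)) R (\<bar>R\<bar> + 1)"
  proof (rule tame_boundI)
    fix D t :: real and X Y :: "real \<Rightarrow> 'b"
    assume h: "\<forall>t. norm (X t) \<le> R" "\<forall>t. norm (X t - Y t) \<le> D" "0 \<le> D"
    have "\<bar>f (X t) - f (Y t)\<bar> = \<bar>f (X t - Y t)\<bar>"
      using assms(1) by (simp add: linear_diff bounded_linear.linear)
    also have "\<dots> \<le> 1 * D"
      using assms(2)[of "X t - Y t"] spec[OF h(2), of t] by linarith
    also have "\<dots> \<le> (\<bar>R\<bar> + 1) * D"
      using h(3) by (intro mult_right_mono) auto
    finally show "\<bar>f (X t)\<bar> \<le> \<bar>R\<bar> + 1 \<and> \<bar>f (X t) - f (Y t)\<bar> \<le> (\<bar>R\<bar> + 1) * D"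
      using assms(2)[of "X t"] spec[OF h(1), of t] by linarith
  qed auto
qed

lemma tame_add:
  fixes \<Phi> :: "real \<Rightarrow> (real \<Rightarrow> 'a::real_normed_vector) \<Rightarrow> real \<Rightarrow> real"
  assumes "tame p \<Phi>" "tame p \<Psi>"
  shows "tame p (\<lambda>\<epsilon> X t. \<Phi> \<epsilon> X t + \<Psi> \<epsilon> X t)"
  unfolding tame_def
proof (intro conjI allI impI)
  show "continuous_on UNIV (\<lambda>t. \<Phi> \<epsilon> X t + \<Psi> \<epsilon> X t)" if "continuous_on UNIV X" for \<epsilon> X
    using that by (intro continuous_intros tame_continuous[OF assms(1)] tame_continuous[OF assms(2)])
  fix R
  obtain L M where LM: "0 \<le> L" "tame_bound p \<Phi> R L" "0 \<le> M" "tame_bound p \<Psi> R M"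
    using tameE assms by metis
  have "tame_bound p (\<lambda>\<epsilon> X t. \<Phi> \<epsilon> X t + \<Psi> \<epsilon> X t) R (L + M)"
  proof (rule tame_boundI)
    fix \<epsilon> D t :: real and X Y :: "real \<Rightarrow> 'a"
    assume h: "\<bar>\<epsilon>\<bar> \<le> 1" "continuous_on UNIV X" "continuous_on UNIV Y" "\<forall>t. norm (X t) \<le> R"
      "\<forall>t. norm (Y t) \<le> R" "\<forall>t. norm (X t - Y t) \<le> D" "t \<in> {0..p}"
    show "\<bar>\<Phi> \<epsilon> X t + \<Psi> \<epsilon> X t\<bar> \<le> L + M \<and>
        \<bar>\<Phi> \<epsilon> X t + \<Psi> \<epsilon> X t - (\<Phi> \<epsilon> Y t + \<Psi> \<epsilon> Y t)\<bar> \<le> (L + M) * D"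
      using tame_boundD[OF LM(2) h] tame_boundD[OF LM(4) h] by (auto simp: algebra_simps)
  qed (use LM in auto)
  thus "\<exists>L. tame_bound p (\<lambda>\<epsilon> X t. \<Phi> \<epsilon> X t + \<Psi> \<epsilon> X t) R L" ..
qed

lemma tame_mult:
  fixes \<Phi> :: "real \<Rightarrow> (real \<Rightarrow> 'a::real_normed_vector) \<Rightarrow> real \<Rightarrow> real"
  assumes "tame p \<Phi>" "tame p \<Psi>"
  shows "tame p (\<lambda>\<epsilon> X t. \<Phi> \<epsilon> X t * \<Psi> \<epsilon> X t)"
  unfolding tame_def
proof (intro conjI allI impI)
  show "continuous_on UNIV (\<lambda>t. \<Phi> \<epsilon> X t * \<Psi> \<epsilon> X t)" if "continuous_on UNIV X" for \<epsilon> X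
    using that by (intro continuous_intros tame_continuous[OF assms(1)] tame_continuous[OF assms(2)])
  fix R
  obtain L M where LM: "0 \<le> L" "tame_bound p \<Phi> R L" "0 \<le> M" "tame_bound p \<Psi> R M"
    using tameE assms by metis
  \<comment> \<open>The product rule gives the Lipschitz constant \<open>2 * (L * M)\<close>, which
    also dominates the bound \<open>L * M\<close>.\<close>
  have "tame_bound p (\<lambda>\<epsilon> X t. \<Phi> \<epsilon> X t * \<Psi> \<epsilon> X t) R (2 * (L * M))"
  proof (rule tame_boundI)
    fix \<epsilon> D t :: real and X Y :: "real \<Rightarrow> 'a"
    assume h: "\<bar>\<epsilon>\<bar> \<le> 1" "continuous_on UNIV X" "continuous_on UNIV Y" "\<forall>t. norm (X t) \<le> R"
      "\<forall>t. norm (Y t) \<le> R" "\<forall>t. norm (X t - Y t) \<le> D" "t \<in> {0..p}"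
    note b = tame_boundD[OF LM(2) h] tame_boundD[OF LM(4) h]
    have "\<bar>\<Phi> \<epsilon> X t * \<Psi> \<epsilon> X t\<bar> \<le> L * M"
      unfolding abs_mult by (intro mult_mono b) (use LM in auto)
    also have "\<dots> \<le> 2 * (L * M)"
      using LM by simp
    finally have 1: "\<bar>\<Phi> \<epsilon> X t * \<Psi> \<epsilon> X t\<bar> \<le> 2 * (L * M)" .
    have "\<bar>\<Phi> \<epsilon> X t * \<Psi> \<epsilon> X t - \<Phi> \<epsilon> Y t * \<Psi> \<epsilon> Y t\<bar>
        = \<bar>\<Phi> \<epsilon> X t * (\<Psi> \<epsilon> X t - \<Psi> \<epsilon> Y t) + (\<Phi> \<epsilon> X t - \<Phi> \<epsilon> Y t) * \<Psi> \<epsilon> Y t\<bar>"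
      by (simp add: algebra_simps)
    also have "\<dots> \<le> \<bar>\<Phi> \<epsilon> X t\<bar> * \<bar>\<Psi> \<epsilon> X t - \<Psi> \<epsilon> Y t\<bar> + \<bar>\<Phi> \<epsilon> X t - \<Phi> \<epsilon> Y t\<bar> * \<bar>\<Psi> \<epsilon> Y t\<bar>"
      by (rule order_trans[OF abs_triangle_ineq]) (simp add: abs_mult)
    also have "\<dots> \<le> L * (M * D) + (L * D) * M"
      using b LM by (intro add_mono mult_mono) (auto intro: order_trans[OF abs_ge_zero])
    finally show "\<bar>\<Phi> \<epsilon> X t * \<Psi> \<epsilon> X t\<bar> \<le> 2 * (L * M) \<and>
        \<bar>\<Phi> \<epsilon> X t * \<Psi> \<epsilon> X t - \<Phi> \<epsilon> Y t * \<Psi> \<epsilon> Y t\<bar> \<le> 2 * (L * M) * D"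
      using 1 by (simp add: algebra_simps)
  qed (use LM in auto)
  thus "\<exists>L. tame_bound p (\<lambda>\<epsilon> X t. \<Phi> \<epsilon> X t * \<Psi> \<epsilon> X t) R L" ..
qed

lemma tame_const: "tame p (\<lambda>\<epsilon> X t. c)"
  by (rule tame_fun) auto

lemma tame_minus: "tame p \<Phi> \<Longrightarrow> tame p (\<lambda>\<epsilon> X t. - \<Phi> \<epsilon> X t)"
  using tame_mult[OF tame_const[of p "-1"]] by simp

lemma tame_diff: "tame p \<Phi> \<Longrightarrow> tame p \<Psi> \<Longrightarrow> tame p (\<lambda>\<epsilon> X t. \<Phi> \<epsilon> X t - \<Psi> \<epsilon> X t)"
  using tame_add[OF _ tame_minus] by simp

lemma tame_divide: "tame p \<Phi> \<Longrightarrow> tame p (\<lambda>\<epsilon> X t. \<Phi> \<epsilon> X t / c)"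
  using tame_mult[OF _ tame_const[of p "1 / c"]] by simp

lemma tame_power2: "tame p \<Phi> \<Longrightarrow> tame p (\<lambda>\<epsilon> X t. (\<Phi> \<epsilon> X t)\<^sup>2)"
  unfolding power2_eq_square by (rule tame_mult)

text \<open>Integrals over a full period are numbers; they enter the calculus as operators whose
  value is constant in \<open>t\<close>.\<close>

lemma tame_eval:
  fixes \<Phi> :: "real \<Rightarrow> (real \<Rightarrow> 'a::real_normed_vector) \<Rightarrow> real \<Rightarrow> real"
  assumes "tame p \<Phi>" "p \<ge> 0"
  shows "tame p (\<lambda>\<epsilon> X t. \<Phi> \<epsilon> X p)"
  unfolding tame_def
proof (intro conjI allI impI)
  fix R
  obtain L where "tame_bound p \<Phi> R L"
    using tameE assms by metis
  hence "tame_bound p (\<lambda>\<epsilon> X t. \<Phi> \<epsilon> X p) R L"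
    using assms(2) unfolding tame_bound_def by (auto; meson order_refl)
  thus "\<exists>L. tame_bound p (\<lambda>\<epsilon> X t. \<Phi> \<epsilon> X p) R L" ..
qed auto

lemma tame_primitive:
  fixes \<Phi> :: "real \<Rightarrow> (real \<Rightarrow> 'a::real_normed_vector) \<Rightarrow> real \<Rightarrow> real"
  assumes "tame p \<Phi>" "p \<ge> 0"
  shows "tame p (\<lambda>\<epsilon> X. primitive (\<Phi> \<epsilon> X))"
  unfolding tame_def
proof (intro conjI allI impI)
  show "continuous_on UNIV (primitive (\<Phi> \<epsilon> X))" if "continuous_on UNIV X" for \<epsilon> X
    using that by (intro continuous_on_primitive tame_continuous[OF assms(1)])
  fix R
  obtain L where L: "0 \<le> L" "tame_bound p \<Phi> R L"
    using tameE assms by metis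
  have "tame_bound p (\<lambda>\<epsilon> X. primitive (\<Phi> \<epsilon> X)) R (p * L)"
  proof (rule tame_boundI)
    fix \<epsilon> D t :: real and X Y :: "real \<Rightarrow> 'a"
    assume h: "\<bar>\<epsilon>\<bar> \<le> 1" "continuous_on UNIV X" "continuous_on UNIV Y" "\<forall>t. norm (X t) \<le> R"
      "\<forall>t. norm (Y t) \<le> R" "\<forall>t. norm (X t - Y t) \<le> D" "t \<in> {0..p}"
    note c = tame_continuous[OF assms(1) h(2), of \<epsilon>] tame_continuous[OF assms(1) h(3), of \<epsilon>]
    note b = tame_boundD[OF L(2) h(1-6)]
    have "\<bar>primitive (\<Phi> \<epsilon> X) t\<bar> \<le> p * L"
      by (rule primitive_bound[OF c(1) b(1) h(7)])
    moreover have "\<bar>primitive (\<lambda>s. \<Phi> \<epsilon> X s - \<Phi> \<epsilon> Y s) t\<bar> \<le> p * (L * D)"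
      by (rule primitive_bound[OF continuous_on_diff[OF c] b(3) h(7)])
    ultimately show "\<bar>primitive (\<Phi> \<epsilon> X) t\<bar> \<le> p * L \<and>
        \<bar>primitive (\<Phi> \<epsilon> X) t - primitive (\<Phi> \<epsilon> Y) t\<bar> \<le> p * L * D"
      using c by (simp add: primitive_diff mult.assoc)
  qed (use L assms(2) in auto)
  thus "\<exists>L. tame_bound p (\<lambda>\<epsilon> X. primitive (\<Phi> \<epsilon> X)) R L" ..
qed

lemma tame_primitive_eval:
  "tame p \<Phi> \<Longrightarrow> p \<ge> 0 \<Longrightarrow> tame p (\<lambda>\<epsilon> X t. primitive (\<Phi> \<epsilon> X) p)"
  by (rule tame_eval[OF tame_primitive])

text \<open>On \<open>{-L..L}\<close> the derivative bound makes \<open>h \<epsilon>\<close>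
  Lipschitz with constant \<open>L\<^sup>2\<close>, uniformly in \<epsilon>. The rule is tailored to
  the rescaled Taylor remainders \<open>sin_rem\<close> and \<open>cos_rem\<close>.\<close>

lemma tame_compose:
  fixes \<Phi> :: "real \<Rightarrow> (real \<Rightarrow> 'a::real_normed_vector) \<Rightarrow> real \<Rightarrow> real"
  assumes "tame p \<Phi>" and h0: "\<And>\<epsilon>. h \<epsilon> 0 = 0"
    and der: "\<And>\<epsilon> x. (h \<epsilon> has_real_derivative h' \<epsilon> x) (at x)"
    and bound: "\<And>\<epsilon> x. \<bar>h' \<epsilon> x\<bar> \<le> x\<^sup>2"
  shows "tame p (\<lambda>\<epsilon> X t. h \<epsilon> (\<Phi> \<epsilon> X t))"
  unfolding tame_def
proof (intro conjI allI impI)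
  show "continuous_on UNIV (\<lambda>t. h \<epsilon> (\<Phi> \<epsilon> X t))" if "continuous_on UNIV X" for \<epsilon> X
    by (rule continuous_on_compose2[OF continuous_on_of_derivative[OF der] tame_continuous[OF assms(1) that]])
      auto
  have lip: "\<bar>h \<epsilon> x - h \<epsilon> y\<bar> \<le> L\<^sup>2 * \<bar>x - y\<bar>" if "\<bar>x\<bar> \<le> L" "\<bar>y\<bar> \<le> L" for \<epsilon> x y L
  proof -
    have "norm (h \<epsilon> x - h \<epsilon> y) \<le> L\<^sup>2 * norm (x - y)"
    proof (rule field_differentiable_bound[where S = "{-L..L}" and f' = "h' \<epsilon>"])
      show "norm (h' \<epsilon> z) \<le> L\<^sup>2" if "z \<in> {-L..L}" for z
      proof -
        have "\<bar>z\<bar>\<^sup>2 \<le> L\<^sup>2"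
          using that by (intro power_mono) auto
        thus ?thesis using bound[of \<epsilon> z] by simp
      qed
    qed (use that in \<open>auto intro: has_field_derivative_at_within der\<close>)
    thus ?thesis by simp
  qed
  fix R
  obtain L where L: "0 \<le> L" "tame_bound p \<Phi> R L"
    using tameE assms by metis
  have "tame_bound p (\<lambda>\<epsilon> X t. h \<epsilon> (\<Phi> \<epsilon> X t)) R (L\<^sup>2 * L)"
  proof (rule tame_boundI)
    fix \<epsilon> D t :: real and X Y :: "real \<Rightarrow> 'a"
    assume H: "\<bar>\<epsilon>\<bar> \<le> 1" "continuous_on UNIV X" "continuous_on UNIV Y" "\<forall>t. norm (X t) \<le> R"
      "\<forall>t. norm (Y t) \<le> R" "\<forall>t. norm (X t - Y t) \<le> D" "t \<in> {0..p}"
    note b = tame_boundD[OF L(2) H]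
    have "\<bar>h \<epsilon> (\<Phi> \<epsilon> X t) - h \<epsilon> 0\<bar> \<le> L\<^sup>2 * \<bar>\<Phi> \<epsilon> X t - 0\<bar>"
      by (rule lip) (use b L in auto)
    also have "\<dots> \<le> L\<^sup>2 * L"
      using b by (intro mult_left_mono) auto
    finally have 1: "\<bar>h \<epsilon> (\<Phi> \<epsilon> X t)\<bar> \<le> L\<^sup>2 * L"
      by (simp add: h0)
    have "\<bar>h \<epsilon> (\<Phi> \<epsilon> X t) - h \<epsilon> (\<Phi> \<epsilon> Y t)\<bar> \<le> L\<^sup>2 * \<bar>\<Phi> \<epsilon> X t - \<Phi> \<epsilon> Y t\<bar>"
      by (rule lip) (use b L in auto)
    also have "\<dots> \<le> L\<^sup>2 * (L * D)"
      using b by (intro mult_left_mono) auto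
    finally show "\<bar>h \<epsilon> (\<Phi> \<epsilon> X t)\<bar> \<le> L\<^sup>2 * L \<and>
        \<bar>h \<epsilon> (\<Phi> \<epsilon> X t) - h \<epsilon> (\<Phi> \<epsilon> Y t)\<bar> \<le> L\<^sup>2 * L * D"
      using 1 by (simp add: mult.assoc)
  qed (use L in auto)
  thus "\<exists>L. tame_bound p (\<lambda>\<epsilon> X t. h \<epsilon> (\<Phi> \<epsilon> X t)) R L" ..
qed

section \<open>Periodic fixed points of small perturbations\<close>

definition periodic_ball :: "real \<Rightarrow> real \<Rightarrow> (real \<Rightarrow> 'b::real_normed_vector) set" where
  "periodic_ball p R = {X. continuous_on UNIV X \<and> (\<forall>t. X (t + p) = X t) \<and> (\<forall>t. norm (X t) \<le> R)}"

lemma periodic_ball_mono: "R \<le> S \<Longrightarrow> periodic_ball p R \<subseteq> periodic_ball p S"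
  by (auto simp: periodic_ball_def intro: order_trans)

text \<open>Banach's fixed-point theorem in the complete space of bounded continuous functions:
  periodicity and the norm bound survive pointwise limits, so the ball is a closed subset.\<close>

lemma periodic_ball_fixpoint:
  fixes T :: "(real \<Rightarrow> 'b::banach) \<Rightarrow> real \<Rightarrow> 'b"
  assumes "R \<ge> 0" and self: "\<And>X. X \<in> periodic_ball p R \<Longrightarrow> T X \<in> periodic_ball p R"
    and lip: "\<And>X Y D t. X \<in> periodic_ball p R \<Longrightarrow> Y \<in> periodic_ball p R \<Longrightarrow>
      \<forall>t. norm (X t - Y t) \<le> D \<Longrightarrow> norm (T X t - T Y t) \<le> D / 2"
  shows "\<exists>X\<in>periodic_ball p R. T X = X"
proof -
  define S where "S = {f :: real \<Rightarrow>\<^sub>C 'b. apply_bcontfun f \<in> periodic_ball p R}"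
  define F where "F f = Bcontfun (T (apply_bcontfun f))" for f :: "real \<Rightarrow>\<^sub>C 'b"
  have inv: "apply_bcontfun (Bcontfun X) = X" if "X \<in> periodic_ball p R" for X :: "real \<Rightarrow> 'b"
    by (rule Bcontfun_inverse) (use that in \<open>auto simp: periodic_ball_def intro: bcontfun_normI\<close>)
  have F: "apply_bcontfun (F f) = T (apply_bcontfun f)" if "f \<in> S" for f
    using that self unfolding F_def S_def by (auto simp: inv)
  have "closed S"
    unfolding closed_sequential_limits
  proof (intro allI impI, elim conjE)
    fix g l assume g: "\<forall>n. g n \<in> S" "g \<longlonglongrightarrow> l"
    have lim: "(\<lambda>n. apply_bcontfun (g n) t) \<longlonglongrightarrow> apply_bcontfun l t" for t
      using tendsto_uniform_limitI[OF tendsto_bcontfun_uniform_limit[OF g(2)]] by simp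
    have "apply_bcontfun l (t + p) = apply_bcontfun l t" for t
      using lim[of "t + p"] lim[of t] g(1) LIMSEQ_unique by (auto simp: S_def periodic_ball_def)
    moreover have "norm (apply_bcontfun l t) \<le> R" for t
      using g(1) by (intro tendsto_upperbound[OF tendsto_norm[OF lim[of t]]])
        (auto simp: S_def periodic_ball_def)
    ultimately show "l \<in> S"
      by (auto simp: S_def periodic_ball_def)
  qed
  moreover have "(\<lambda>_. 0) \<in> periodic_ball p R"
    using \<open>R \<ge> 0\<close> by (auto simp: periodic_ball_def)
  hence "Bcontfun (\<lambda>_. 0) \<in> S"
    unfolding S_def mem_Collect_eq by (subst inv)
  moreover have "F ` S \<subseteq> S"
    using F self by (auto simp: S_def)
  moreover have "dist (F f) (F g) \<le> 1 / 2 * dist f g" if "f \<in> S" "g \<in> S" for f g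
  proof (rule dist_bound)
    fix t
    have "\<forall>s. norm (apply_bcontfun f s - apply_bcontfun g s) \<le> dist f g"
      using dist_bounded[of f _ g] by (simp add: dist_norm)
    from lip[OF _ _ this, of t] that
    show "dist (apply_bcontfun (F f) t) (apply_bcontfun (F g) t) \<le> 1 / 2 * dist f g"
      by (auto simp: F S_def dist_norm)
  qed
  ultimately have "\<exists>!f\<in>S. F f = f"
    by (intro Banach_fix[where c = "1/2"]) (auto simp: complete_eq_closed)
  then obtain f where "f \<in> S" "F f = f" by blast
  thus ?thesis
    using F[of f] by (intro bexI[of _ "apply_bcontfun f"]) (auto simp: S_def)
qed

text \<open>Starting from the trivial bound \<open>2 * R\<close>, the contraction estimate halves
  the distance of the two fixed points again and again. Uniqueness is kept apart from existence so
  that it applies on a larger ball, where \<open>T\<close> contracts but may fail to map the ball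
  into itself.\<close>

lemma periodic_ball_unique_fixpoint:
  fixes T :: "(real \<Rightarrow> 'b::real_normed_vector) \<Rightarrow> real \<Rightarrow> 'b"
  assumes lip: "\<And>D t. \<forall>t. norm (X t - Y t) \<le> D \<Longrightarrow> norm (T X t - T Y t) \<le> D / 2"
    and "T X = X" "T Y = Y" "X \<in> periodic_ball p R" "Y \<in> periodic_ball p R"
  shows "X = Y"
proof
  fix t
  have "\<forall>t. norm (X t - Y t) \<le> 2 * R * (1 / 2) ^ n" for n
  proof (induction n)
    case 0
    show ?case
    proof
      fix t
      have "norm (X t - Y t) \<le> norm (X t) + norm (Y t)"
        by (rule norm_triangle_ineq4)
      also have "\<dots> \<le> R + R"
        using assms(4,5) by (intro add_mono) (auto simp: periodic_ball_def)
      finally show "norm (X t - Y t) \<le> 2 * R * (1 / 2) ^ 0" by simp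
    qed
  next
    case (Suc n)
    thus ?case
      using lip[OF Suc.IH] assms(2,3) by simp
  qed
  hence "norm (X t - Y t) \<le> 2 * R * (1 / 2) ^ n" for n by blast
  moreover have "(\<lambda>n. 2 * R * (1 / 2) ^ n) \<longlonglongrightarrow> 2 * R * 0"
    by (intro tendsto_mult tendsto_const LIMSEQ_power_zero) auto
  ultimately have "norm (X t - Y t) \<le> 2 * R * 0"
    by (intro tendsto_lowerbound[of "\<lambda>n. 2 * R * (1 / 2) ^ n"]) auto
  thus "X t = Y t" by simp
qed

section \<open>The linearised pendulum\<close>

text \<open>Here \<open>p\<close> is some period, possibly a multiple of the minimal one. The
  excluded energies \<open>E = 4 * c\<^sup>2\<close> and \<open>E = - 4 * c\<^sup>2\<close> are
  those of the separatrix and of the equilibria.\<close>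

locale pendulum_orbit =
  fixes c p E :: real and \<psi>\<^sub>0 \<phi> :: "real \<Rightarrow> real"
  assumes p_pos: "p > 0"
    and psi0_derivative: "\<And>t. (\<psi>\<^sub>0 has_real_derivative \<phi> t) (at t)"
    and phi_derivative: "\<And>t. (\<phi> has_real_derivative 4 * c\<^sup>2 * sin (\<psi>\<^sub>0 t)) (at t)"
    and psi0_periodic: "\<And>t. \<psi>\<^sub>0 (t + p) = \<psi>\<^sub>0 t"
    and energy: "\<And>t. (\<phi> t)\<^sup>2 / 2 + 4 * c\<^sup>2 * cos (\<psi>\<^sub>0 t) = E"
    and energy_noncritical: "E\<^sup>2 \<noteq> 16 * c ^ 4"
begin

definition "\<phi>' t = 4 * c\<^sup>2 * sin (\<psi>\<^sub>0 t)"
definition "q t = 4 * c\<^sup>2 * cos (\<psi>\<^sub>0 t)"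
text \<open>This constant is the Wronskian of \<phi> and \<open>y\<close>.\<close>

definition "W = E\<^sup>2 - 16 * c ^ 4"
definition "N = primitive (\<lambda>s. (\<phi> s)\<^sup>2) p"

text \<open>The constant \<open>1/4\<close> makes \<open>y\<close> a second solution of \<open>h'' = q h\<close>; its secular growth
  \<open>y (t + p) - y t = (N / 4) \<phi> t\<close> replaces the usual condition that the period of the pendulum depends
  strictly monotonically on the energy.\<close>

definition "y t = \<phi>' t + primitive (\<lambda>s. (\<phi> s)\<^sup>2) t / 4 * \<phi> t"
definition "y' t = q t * \<phi> t + (\<phi> t) ^ 3 / 4 + primitive (\<lambda>s. (\<phi> s)\<^sup>2) t / 4 * \<phi>' t"

lemma W_nonzero: "W \<noteq> 0"
  using energy_noncritical by (simp add: W_def)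

lemma continuous_orbit:
  "continuous_on S \<psi>\<^sub>0" "continuous_on S \<phi>" "continuous_on S \<phi>'" "continuous_on S q"
proof -
  show "continuous_on S \<psi>\<^sub>0" for S
    by (rule continuous_on_of_derivative[OF psi0_derivative])
  thus "continuous_on S \<phi>'" "continuous_on S q"
    unfolding \<phi>'_def[abs_def] q_def[abs_def] by (intro continuous_intros; simp)+
  show "continuous_on S \<phi>"
    by (rule continuous_on_of_derivative[OF phi_derivative])
qed

lemma continuous_phi_sq: "continuous_on S (\<lambda>s. (\<phi> s)\<^sup>2)"
  by (intro continuous_intros continuous_orbit)

lemma orbit_derivatives:
  "(\<psi>\<^sub>0 has_real_derivative \<phi> t) (at t)"
  "(\<phi> has_real_derivative \<phi>' t) (at t)"
  "(\<phi>' has_real_derivative q t * \<phi> t) (at t)"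
  "(q has_real_derivative - \<phi>' t * \<phi> t) (at t)"
  "(y has_real_derivative y' t) (at t)"
  "(y' has_real_derivative q t * y t) (at t)"
proof -
  note [derivative_intros] = DERIV_chain2[OF psi0_derivative] DERIV_chain2[OF phi_derivative]
  show psi: "(\<psi>\<^sub>0 has_real_derivative \<phi> t) (at t)" and phi: "(\<phi> has_real_derivative \<phi>' t) (at t)"
    using psi0_derivative phi_derivative by (auto simp: \<phi>'_def)
  show phi': "(\<phi>' has_real_derivative q t * \<phi> t) (at t)"
    unfolding \<phi>'_def[abs_def] q_def
    by (rule derivative_eq_intros refl psi0_derivative)+ simp
  show q: "(q has_real_derivative - \<phi>' t * \<phi> t) (at t)"
    unfolding q_def[abs_def] \<phi>'_def
    by (rule derivative_eq_intros refl psi0_derivative)+ simp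
  note I = primitive_has_derivative[OF continuous_phi_sq]
  show "(y has_real_derivative y' t) (at t)"
    unfolding y_def[abs_def] y'_def
    by (rule DERIV_cdivide derivative_eq_intros refl phi phi' I)+ (simp add: algebra_simps power3_eq_cube power2_eq_square)
  \<comment> \<open>The derivative of \<open>q\<close> contributes
    \<open>- \<phi>' * \<phi>\<^sup>2\<close>. It cancels against three quarters of
    \<open>\<phi>\<^sup>2 * \<phi>'\<close> from the cube and one quarter from the
    primitive.\<close>
  show "(y' has_real_derivative q t * y t) (at t)"
    unfolding y'_def[abs_def] y_def
    by (rule DERIV_cdivide derivative_eq_intros refl phi phi' q I)+ (simp add: algebra_simps power3_eq_cube power2_eq_square)
qed

lemma continuous_second: "continuous_on S y" "continuous_on S y'"
  by (rule continuous_on_of_derivative[OF orbit_derivatives(5)] continuous_on_of_derivative[OF orbit_derivatives(6)])+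

lemma orbit_periodic:
  "\<phi> (t + p) = \<phi> t" "\<phi>' (t + p) = \<phi>' t" "q (t + p) = q t"
  using derivative_periodic[OF orbit_derivatives(1) psi0_periodic]
  by (auto simp: \<phi>'_def q_def psi0_periodic)

lemma energy': "(\<phi> t)\<^sup>2 = 2 * (E - q t)"
  using energy[of t] by (simp add: q_def)

text \<open>The primitive drops out of the Wronskian. The energy identity eliminates
  \<open>\<phi>\<^sup>2\<close>, and what remains is
  \<open>E\<^sup>2 - (q\<^sup>2 + \<phi>'\<^sup>2)\<close>, where the bracket is constant by the
  Pythagorean identity.\<close>

lemma wronskian: "\<phi> t * y' t - \<phi>' t * y t = W"
proof -
  have "(q t)\<^sup>2 + (\<phi>' t)\<^sup>2 = (4 * c\<^sup>2)\<^sup>2 * ((cos (\<psi>\<^sub>0 t))\<^sup>2 + (sin (\<psi>\<^sub>0 t))\<^sup>2)"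
    unfolding q_def \<phi>'_def power_mult_distrib by (simp only: distrib_left)
  hence 1: "(q t)\<^sup>2 + (\<phi>' t)\<^sup>2 = 16 * c ^ 4"
    by (simp add: power_mult_distrib)
  have "\<phi> t * y' t - \<phi>' t * y t = q t * (\<phi> t)\<^sup>2 + ((\<phi> t)\<^sup>2)\<^sup>2 / 4 - (\<phi>' t)\<^sup>2"
    by (simp add: y_def y'_def algebra_simps power2_eq_square power3_eq_cube)
  also have "\<dots> = E\<^sup>2 - ((q t)\<^sup>2 + (\<phi>' t)\<^sup>2)"
    unfolding energy' by (simp add: field_simps power2_eq_square)
  finally show ?thesis
    by (simp add: 1 W_def)
qed

text \<open>If \<phi> vanished on one period it would vanish identically, together with
  \<open>\<phi>'\<close>, and the Wronskian would be zero.\<close>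

lemma N_pos: "N > 0"
proof -
  obtain s where s: "s \<in> {0..p}" "\<phi> s \<noteq> 0"
  proof (rule ccontr)
    assume "\<not> thesis"
    hence 0: "\<phi> s = 0" if "s \<in> {0..p}" for s
      using that \<open>\<And>s. \<lbrakk>s \<in> {0..p}; \<phi> s \<noteq> 0\<rbrakk> \<Longrightarrow> thesis\<close> by blast
    have "\<phi> t = 0" for t
    proof -
      obtain r where "r \<in> {0..p}" "\<phi> t = \<phi> r"
        using periodic_representative[OF p_pos, of t, where 'a = real] orbit_periodic by metis
      thus ?thesis using 0 by simp
    qed
    hence "\<phi> = (\<lambda>_. 0)" by blast
    hence "\<phi>' 0 = 0"
      using orbit_derivatives(2)[of 0] DERIV_const DERIV_unique by metis
    thus False
      using wronskian[of 0] W_nonzero \<open>\<phi> = (\<lambda>_. 0)\<close> by simp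
  qed
  have "integral {0..p} (\<lambda>s. (\<phi> s)\<^sup>2) \<noteq> 0"
    using s integral_eq_0_iff[OF continuous_phi_sq p_pos] by auto
  moreover have "integral {0..p} (\<lambda>s. (\<phi> s)\<^sup>2) \<ge> 0"
    by (rule integral_nonneg) (auto intro: integrable_continuous_real continuous_phi_sq)
  ultimately show ?thesis
    using primitive_eq_integral[OF continuous_phi_sq, of p] p_pos by (simp add: N_def)
qed

lemma y_shift: "y (t + p) = y t + N / 4 * \<phi> t"
  using primitive_shift[OF continuous_phi_sq, of t p]
  unfolding y_def orbit_periodic N_def by (simp add: field_simps)

section \<open>Solvability, kernel and Green operator of the periodic linearised equation\<close>

lemma solvability:
  assumes "\<And>t. (h has_real_derivative h' t) (at t)"
    "\<And>t. (h' has_real_derivative q t * h t + g t) (at t)"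
    "\<And>t. h (t + p) = h t" "continuous_on UNIV g"
  shows "primitive (\<lambda>t. \<phi> t * g t) p = 0"
proof (rule primitive_of_periodic_derivative)
  \<comment> \<open>The bracket of \<open>h\<close> with the homogeneous solution \<phi> is periodic
    and its derivative is \<open>\<phi> * g\<close>, hence \<phi> is orthogonal to
    \<open>g\<close>.\<close>
  show "((\<lambda>t. \<phi> t * h' t - \<phi>' t * h t) has_real_derivative \<phi> t * g t) (at t)" for t
    by (rule derivative_eq_intros refl orbit_derivatives assms(1,2))+ (simp add: algebra_simps)
  show "continuous_on UNIV (\<lambda>t. \<phi> t * g t)"
    by (intro continuous_intros continuous_orbit assms)
  show "\<phi> (t + p) * h' (t + p) - \<phi>' (t + p) * h (t + p) = \<phi> t * h' t - \<phi>' t * h t" for t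
    using derivative_periodic[OF assms(1,3)] by (simp add: orbit_periodic assms(3))
qed

text \<open>The brackets of \<open>h\<close> with \<phi> and with \<open>y\<close> are constants
  \<open>A\<close> and \<open>B\<close>, and Cramer's rule gives
  \<open>W * h = A * y - B * \<phi>\<close>. Since \<open>y\<close> grows by
  \<open>N / 4 * \<phi>\<close> over a period, periodicity of \<open>h\<close> forces
  \<open>A = 0\<close>.\<close>

lemma periodic_kernel:
  assumes "\<And>t. (h has_real_derivative h' t) (at t)"
    "\<And>t. (h' has_real_derivative q t * h t) (at t)" "\<And>t. h (t + p) = h t"
  obtains a where "\<And>t. h t = a * \<phi> t" "\<And>t. h' t = a * \<phi>' t"
proof -
  have "((\<lambda>t. \<phi> t * h' t - \<phi>' t * h t) has_real_derivative 0) (at t)" for t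
    by (rule derivative_eq_intros refl orbit_derivatives assms(1,2))+ (simp add: algebra_simps)
  then obtain A where A: "\<And>t. \<phi> t * h' t - \<phi>' t * h t = A"
    using DERIV_isconst_all by blast
  have "((\<lambda>t. y t * h' t - y' t * h t) has_real_derivative 0) (at t)" for t
    by (rule derivative_eq_intros refl orbit_derivatives assms(1,2))+ (simp add: algebra_simps)
  then obtain B where B: "\<And>t. y t * h' t - y' t * h t = B"
    using DERIV_isconst_all by blast
  have h: "W * h t = A * y t - B * \<phi> t" for t
    unfolding A[of t, symmetric] B[of t, symmetric] wronskian[of t, symmetric]
    by (simp add: algebra_simps)
  obtain s where "\<phi> s \<noteq> 0"
    using N_pos by (fastforce simp: N_def primitive_def)
  moreover have "A * (N / 4 * \<phi> s) = 0"
    using h[of s] h[of "s + p"] unfolding assms(3) y_shift orbit_periodic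
    by (simp only: distrib_left)
  ultimately have "A = 0"
    using N_pos by simp
  hence h1: "h t = - B / W * \<phi> t" for t
    using h[of t] W_nonzero by (simp add: field_simps)
  have "(h has_real_derivative - B / W * \<phi>' t) (at t)" for t
    using DERIV_cmult[OF orbit_derivatives(2), of "- B / W" t] h1 by presburger
  hence "h' t = - B / W * \<phi>' t" for t
    using assms(1) DERIV_unique by blast
  with h1 show ?thesis
    using that by blast
qed

text \<open>A periodic solution of \<open>h'' = q h + projection g\<close>, obtained by variation of constants; the projection
  enforces the solvability condition.\<close>

definition "projection g t = g t - primitive (\<lambda>s. \<phi> s * g s) p / N * \<phi> t"

text \<open>The constant of integration \<open>4 / (N * W) * ...\<close> is chosen so that
  \<open>coeff_phi\<close> loses exactly \<open>N / 4 * coeff_y\<close> over a period, which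
  compensates the secular growth of \<open>y\<close>.\<close>

definition "coeff_y g t =
  4 / (N * W) * primitive (\<lambda>s. y s * projection g s) p + primitive (\<lambda>s. \<phi> s * projection g s) t / W"
definition "coeff_phi g t = - primitive (\<lambda>s. y s * projection g s) t / W"

definition "green g t = coeff_y g t * y t + coeff_phi g t * \<phi> t"
definition "green' g t = coeff_y g t * y' t + coeff_phi g t * \<phi>' t"

lemma continuous_projection:
  "continuous_on UNIV g \<Longrightarrow> continuous_on UNIV (projection g)"
  unfolding projection_def[abs_def] by (intro continuous_intros continuous_orbit)

lemma projection_orthogonal:
  assumes "continuous_on UNIV g"
  shows "primitive (\<lambda>s. \<phi> s * projection g s) p = 0"
proof -
  define k where "k = primitive (\<lambda>s. \<phi> s * g s) p / N"
  have "primitive (\<lambda>s. \<phi> s * projection g s) p = primitive (\<lambda>s. \<phi> s * g s - k * (\<phi> s)\<^sup>2) p"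
    by (simp add: projection_def k_def power2_eq_square algebra_simps)
  also have "\<dots> = primitive (\<lambda>s. \<phi> s * g s) p - k * N"
    unfolding N_def
    by (simp add: primitive_diff primitive_cmult continuous_phi_sq continuous_orbit assms
        continuous_on_mult continuous_on_const)
  finally show ?thesis
    using N_pos by (simp add: k_def)
qed

lemma projection_eq: "primitive (\<lambda>s. \<phi> s * g s) p = 0 \<Longrightarrow> projection g = g"
  by (simp add: projection_def fun_eq_iff)

text \<open>Variation of constants: the derivatives of the coefficients cancel in the first
  derivative, and in the second they combine to the Wronskian divided by \<open>W\<close>, that is,
  to the factor \<open>1\<close> in front of the projected forcing.\<close>

lemma green_derivative:
  assumes "continuous_on UNIV g"
  shows "(green g has_real_derivative green' g t) (at t)"
    "(green' g has_real_derivative q t * green g t + projection g t) (at t)"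
proof -
  have c: "continuous_on UNIV (\<lambda>s. y s * projection g s)" "continuous_on UNIV (\<lambda>s. \<phi> s * projection g s)"
    by (intro continuous_intros continuous_second continuous_orbit continuous_projection assms)+
  have d: "(coeff_y g has_real_derivative \<phi> t * projection g t / W) (at t)"
    "(coeff_phi g has_real_derivative - (y t * projection g t) / W) (at t)"
    unfolding coeff_y_def[abs_def] coeff_phi_def[abs_def]
    by (rule derivative_eq_intros refl primitive_has_derivative c | simp add: W_nonzero)+
  show "(green g has_real_derivative green' g t) (at t)"
    unfolding green_def[abs_def] green'_def
    by (rule derivative_eq_intros refl d orbit_derivatives)+ (simp add: algebra_simps)
  have "(green' g has_real_derivative
      q t * green g t + (\<phi> t * y' t - \<phi>' t * y t) / W * projection g t) (at t)"
    unfolding green'_def[abs_def] green_def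
    by (rule derivative_eq_intros refl d orbit_derivatives)+ (simp add: algebra_simps diff_divide_distrib)
  thus "(green' g has_real_derivative q t * green g t + projection g t) (at t)"
    by (simp add: wronskian W_nonzero)
qed

text \<open>Orthogonality of the projected forcing to \<phi> makes \<open>coeff_y\<close> periodic;
  the drift of \<open>coeff_phi\<close> cancels that of \<open>y\<close>.\<close>

lemma green_periodic:
  assumes "continuous_on UNIV g" "\<And>t. g (t + p) = g t"
  shows "green g (t + p) = green g t" "green' g (t + p) = green' g t"
proof -
  have cp: "continuous_on UNIV (projection g)" and pp: "\<And>t. projection g (t + p) = projection g t"
    using continuous_projection[OF assms(1)] by (auto simp: assms(2) projection_def orbit_periodic)
  have c: "continuous_on UNIV (\<lambda>s. y s * projection g s)" "continuous_on UNIV (\<lambda>s. \<phi> s * projection g s)"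
    by (intro continuous_intros continuous_second continuous_orbit cp)+
  have 1: "coeff_y g (t + p) = coeff_y g t" for t
    unfolding coeff_y_def using primitive_shift[OF c(2), of t p]
    by (simp add: projection_orthogonal[OF assms(1)] pp orbit_periodic)
  have 2: "coeff_phi g (t + p) = coeff_phi g t - N / 4 * coeff_y g t" for t
  proof -
    have "primitive (\<lambda>s. y (s + p) * projection g (s + p)) t
        = primitive (\<lambda>s. y s * projection g s + N / 4 * (\<phi> s * projection g s)) t"
      by (simp add: y_shift pp algebra_simps)
    also have "\<dots> = primitive (\<lambda>s. y s * projection g s) t + N / 4 * primitive (\<lambda>s. \<phi> s * projection g s) t"
      by (simp only: primitive_add[OF c(1) continuous_on_mult[OF continuous_on_const c(2)]]
          primitive_cmult[OF c(2)])
    finally show ?thesis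
      unfolding coeff_phi_def coeff_y_def using primitive_shift[OF c(1), of t p] N_pos W_nonzero
      by (simp add: field_simps)
  qed
  show *: "green g (t + p) = green g t" for t
    unfolding green_def 1 2 y_shift orbit_periodic by (simp add: algebra_simps)
  show "green' g (t + p) = green' g t"
    by (rule derivative_periodic[of "green g" "green' g" p, OF green_derivative(1)[OF assms(1)] *])
qed

lemma tame_green:
  assumes "tame p \<Phi>"
  shows "tame p (\<lambda>\<epsilon> X. green (\<Phi> \<epsilon> X))" "tame p (\<lambda>\<epsilon> X. green' (\<Phi> \<epsilon> X))"
proof -
  have "0 \<le> p" using p_pos by simp
  note fn = continuous_orbit[THEN tame_fun] continuous_second[THEN tame_fun]
  have P: "tame p (\<lambda>\<epsilon> X. projection (\<Phi> \<epsilon> X))"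
    unfolding projection_def[abs_def]
    by (intro tame_diff tame_mult tame_divide tame_primitive_eval tame_primitive assms fn \<open>0 \<le> p\<close>)
  show "tame p (\<lambda>\<epsilon> X. green (\<Phi> \<epsilon> X))" "tame p (\<lambda>\<epsilon> X. green' (\<Phi> \<epsilon> X))"
    unfolding green_def[abs_def] green'_def[abs_def] coeff_y_def coeff_phi_def
    by (intro tame_add tame_mult tame_divide tame_minus tame_primitive_eval tame_primitive tame_const P fn \<open>0 \<le> p\<close>)+
qed

end

section \<open>Taylor remainders\<close>

text \<open>Division by \<open>\<epsilon> ^ 3\<close> leaves a quantity that stays bounded for
  bounded \<open>x\<close> as \<epsilon> tends to zero. At \<open>\<epsilon> = 0\<close> the
  quotient is \<open>0\<close> by the convention on division, so the uniform estimates include that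
  value.\<close>

definition sin_rem :: "real \<Rightarrow> real \<Rightarrow> real" where
  "sin_rem \<epsilon> x = (sin (\<epsilon> * x) - \<epsilon> * x) / \<epsilon> ^ 3"

definition cos_rem :: "real \<Rightarrow> real \<Rightarrow> real" where
  "cos_rem \<epsilon> x = (cos (\<epsilon> * x) - 1 + (\<epsilon> * x)\<^sup>2 / 2) / \<epsilon> ^ 3"

lemma one_minus_cos_bound: "\<bar>cos x - 1\<bar> \<le> x\<^sup>2" for x :: real
proof -
  have "\<bar>sin (x / 2)\<bar>\<^sup>2 \<le> \<bar>x / 2\<bar>\<^sup>2"
    by (intro power_mono abs_sin_x_le_abs_x) auto
  hence "(sin (x / 2))\<^sup>2 \<le> x\<^sup>2 / 4"
    by (simp add: power_divide)
  moreover have "cos x - 1 = - 2 * (sin (x / 2))\<^sup>2"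
    using cos_double_sin[of "x / 2"] by simp
  moreover have "0 \<le> (sin (x / 2))\<^sup>2" "0 \<le> x\<^sup>2"
    by simp_all
  ultimately show ?thesis by linarith
qed

lemma sin_minus_bound: "\<bar>x - sin x\<bar> \<le> x\<^sup>2" for x :: real
proof -
  have "\<bar>sin x - x\<bar> \<le> x\<^sup>2 / 2"
    using Maclaurin_sin_bound[of x 2] by (simp add: numeral_2_eq_2 sin_coeff_def)
  moreover have "x\<^sup>2 / 2 \<le> x\<^sup>2" by simp
  ultimately show ?thesis by linarith
qed

text \<open>Differentiating in \<open>x\<close> cancels one factor \<epsilon>; the remaining
  quotient by \<open>\<epsilon>\<^sup>2\<close> is at most \<open>x\<^sup>2\<close> by the quadratic
  bounds on \<open>cos x - 1\<close> and \<open>x - sin x\<close>.\<close>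

lemma tame_remainders:
  fixes \<Phi> :: "real \<Rightarrow> (real \<Rightarrow> 'b::real_normed_vector) \<Rightarrow> real \<Rightarrow> real"
  assumes "tame p \<Phi>"
  shows "tame p (\<lambda>\<epsilon> X t. sin_rem \<epsilon> (\<Phi> \<epsilon> X t))" "tame p (\<lambda>\<epsilon> X t. cos_rem \<epsilon> (\<Phi> \<epsilon> X t))"
proof -
  show "tame p (\<lambda>\<epsilon> X t. sin_rem \<epsilon> (\<Phi> \<epsilon> X t))"
  proof (rule tame_compose[OF assms])
    show "(sin_rem \<epsilon> has_real_derivative (cos (\<epsilon> * x) - 1) / \<epsilon>\<^sup>2) (at x)" for \<epsilon> x :: real
      by (cases "\<epsilon> = 0")
        (auto simp: sin_rem_def[abs_def] field_simps power2_eq_square power3_eq_cube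
          intro!: derivative_eq_intros)
    show "\<bar>(cos (\<epsilon> * x) - 1) / \<epsilon>\<^sup>2\<bar> \<le> x\<^sup>2" for \<epsilon> x :: real
      using one_minus_cos_bound[of "\<epsilon> * x"]
      by (cases "\<epsilon> = 0") (auto simp: divide_le_eq power_mult_distrib mult.commute)
  qed (simp add: sin_rem_def)
  show "tame p (\<lambda>\<epsilon> X t. cos_rem \<epsilon> (\<Phi> \<epsilon> X t))"
  proof (rule tame_compose[OF assms])
    show "(cos_rem \<epsilon> has_real_derivative (\<epsilon> * x - sin (\<epsilon> * x)) / \<epsilon>\<^sup>2) (at x)" for \<epsilon> x :: real
      by (cases "\<epsilon> = 0")
        (auto simp: cos_rem_def[abs_def] field_simps power2_eq_square power3_eq_cube
          intro!: derivative_eq_intros)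
    show "\<bar>(\<epsilon> * x - sin (\<epsilon> * x)) / \<epsilon>\<^sup>2\<bar> \<le> x\<^sup>2" for \<epsilon> x :: real
      using sin_minus_bound[of "\<epsilon> * x"]
      by (cases "\<epsilon> = 0") (auto simp: divide_le_eq power_mult_distrib mult.commute)
  qed (simp add: cos_rem_def)
qed

lemma sin_cos_shift:
  assumes "\<epsilon> \<noteq> 0"
  shows "sin (x + \<epsilon> * u) = sin x * (1 - \<epsilon>\<^sup>2 * u\<^sup>2 / 2 + \<epsilon> ^ 3 * cos_rem \<epsilon> u) + cos x * (\<epsilon> * u + \<epsilon> ^ 3 * sin_rem \<epsilon> u)"
    "cos (x + \<epsilon> * u) = cos x * (1 - \<epsilon>\<^sup>2 * u\<^sup>2 / 2 + \<epsilon> ^ 3 * cos_rem \<epsilon> u) - sin x * (\<epsilon> * u + \<epsilon> ^ 3 * sin_rem \<epsilon> u)"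
  using assms by (simp_all add: sin_add cos_add sin_rem_def cos_rem_def power_mult_distrib)

lemma sin_lipschitz: "\<bar>sin x - sin y\<bar> \<le> \<bar>x - y\<bar>" for x y :: real
proof -
  have "norm (sin x - sin y) \<le> 1 * norm (x - y)"
    by (rule field_differentiable_bound[where S = UNIV and f' = cos])
      (auto intro: DERIV_sin[THEN has_field_derivative_at_within])
  thus ?thesis by simp
qed

section \<open>The perturbed pendulum\<close>

text \<open>The sign of \<open>z\<^sub>0\<close> is left open so that both solutions are treated at
  once. The last two assumptions say that the Melnikov function has a simple zero; in the second one
  the derivative has been moved from \<gamma> to \<phi> by parts.\<close>

locale perturbed_pendulum = pendulum_orbit +
  fixes z\<^sub>0 :: real and \<gamma> :: "real \<Rightarrow> real"
  assumes z0_nonzero: "z\<^sub>0 \<noteq> 0"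
    and gamma_continuous: "continuous_on UNIV \<gamma>"
    and gamma_periodic: "\<And>t. \<gamma> (t + p) = \<gamma> t"
    and melnikov_zero: "primitive (\<lambda>t. \<phi> t * \<gamma> t) p = 0"
    and melnikov_simple: "primitive (\<lambda>t. \<phi>' t * \<gamma> t) p \<noteq> 0"
begin

text \<open>The level \<open>E - 4 * c\<^sup>2 - 2 * z\<^sub>0\<^sup>2\<close> is that of the
  unperturbed state \<open>(\<psi>\<^sub>0, \<phi>, z\<^sub>0)\<close>.\<close>

definition perturbed_orbit :: "real \<Rightarrow> (real \<Rightarrow> real) \<Rightarrow> (real \<Rightarrow> real) \<Rightarrow> (real \<Rightarrow> real) \<Rightarrow> bool" where
  "perturbed_orbit \<epsilon> \<psi> \<psi>' z \<longleftrightarrow>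
     (\<forall>t. (\<psi> has_real_derivative \<psi>' t) (at t)) \<and>
     (\<forall>t. (\<psi>' has_real_derivative 4 * (c\<^sup>2 * sin (\<psi> t) + \<epsilon> * \<gamma> t * z t)) (at t)) \<and>
     (\<forall>t. (z has_real_derivative \<epsilon> * \<gamma> t * \<psi>' t) (at t)) \<and>
     (\<forall>t. (\<psi>' t)\<^sup>2 / 2 - 4 * c\<^sup>2 * (1 - cos (\<psi> t)) - 2 * (z t)\<^sup>2 = E - 4 * c\<^sup>2 - 2 * z\<^sub>0\<^sup>2) \<and>
     (\<forall>t. \<psi> (t + p) = \<psi> t) \<and> (\<forall>t. z (t + p) = z t)"

text \<open>A state \<open>X t = (u, v, w)\<close> encodes \<open>\<psi> = \<psi>\<^sub>0 + \<epsilon> u\<close>, \<open>\<psi>' = \<phi> + \<epsilon> v\<close>, \<open>z = z\<^sub>0 + \<epsilon> w\<close>. The equation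
  of motion becomes \<open>u'' = q u + 4 \<gamma> z\<^sub>0 + \<epsilon> forcing\<close>, and the level set determines \<open>w\<close>.\<close>

definition rem :: "real \<Rightarrow> (real \<Rightarrow> real \<times> real \<times> real) \<Rightarrow> real \<Rightarrow> real" where
  "rem \<epsilon> X t = \<phi>' t * cos_rem \<epsilon> (fst (X t)) + q t * sin_rem \<epsilon> (fst (X t))"

definition "forcing \<epsilon> X t =
  4 * \<gamma> t * snd (snd (X t)) - \<phi>' t / 2 * (fst (X t))\<^sup>2 + \<epsilon> * rem \<epsilon> X t"

text \<open>This is the coefficient of \<open>\<epsilon>\<^sup>2\<close> in the expansion of the
  level function, with all higher orders included.\<close>

definition "level_rem \<epsilon> X t =
  (fst (snd (X t)))\<^sup>2 / 2 + q t * (- (fst (X t))\<^sup>2 / 2 + \<epsilon> * cos_rem \<epsilon> (fst (X t)))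
   - \<epsilon> * \<phi>' t * sin_rem \<epsilon> (fst (X t)) - 2 * (snd (snd (X t)))\<^sup>2"

definition "u\<^sub>0 = green (\<lambda>t. 4 * z\<^sub>0 * \<gamma> t)"
definition "v\<^sub>0 = green' (\<lambda>t. 4 * z\<^sub>0 * \<gamma> t)"
text \<open>This solves the level equation at first order. A multiple of
  \<open>(\<phi>, \<phi>')\<close> added to \<open>(u, v)\<close> drops out of
  \<open>\<phi> * v - \<phi>' * u\<close>, so the unknown coefficient \<open>a\<close> is absent
  from this term.\<close>

definition "w\<^sub>0 t = (\<phi> t * v\<^sub>0 t - \<phi>' t * u\<^sub>0 t) / (4 * z\<^sub>0)"
definition "u\<^sub>1 \<epsilon> X = green (forcing \<epsilon> X)"
definition "v\<^sub>1 \<epsilon> X = green' (forcing \<epsilon> X)"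
definition "w\<^sub>1 \<epsilon> X t = (\<phi> t * v\<^sub>1 \<epsilon> X t - \<phi>' t * u\<^sub>1 \<epsilon> X t + level_rem \<epsilon> X t) / (4 * z\<^sub>0)"

text \<open>With \<open>u = a \<phi> + u\<^sub>0 + \<epsilon> u\<^sub>1\<close> and \<open>w = w\<^sub>0 + \<epsilon> w\<^sub>1\<close> the solvability condition
  \<open>\<integral> \<phi> forcing = 0\<close> is \<open>\<mu> a + \<nu> + \<epsilon> defect = 0\<close>; it is affine in \<open>a\<close> because \<open>\<phi>' \<phi>\<^sup>3\<close> is an exact
  derivative.\<close>

definition "\<mu> = 4 * z\<^sub>0 * primitive (\<lambda>t. \<phi>' t * \<gamma> t) p"
definition "\<nu> = primitive (\<lambda>t. \<phi> t * (4 * \<gamma> t * w\<^sub>0 t - \<phi>' t / 2 * (u\<^sub>0 t)\<^sup>2)) p"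
text \<open>The factor \<open>u\<^sub>1 * (2 * u - \<epsilon> * u\<^sub>1)\<close>, with
  \<open>u\<close> the first component of \<open>X\<close>, is what remains of
  \<open>u\<^sup>2 - (u - \<epsilon> * u\<^sub>1)\<^sup>2\<close> after division by
  \<epsilon>.\<close>

definition "defect_density \<epsilon> X t =
  \<phi> t * (4 * \<gamma> t * w\<^sub>1 \<epsilon> X t - \<phi>' t / 2 * (u\<^sub>1 \<epsilon> X t * (2 * fst (X t) - \<epsilon> * u\<^sub>1 \<epsilon> X t)) + rem \<epsilon> X t)"
definition "defect \<epsilon> X = primitive (defect_density \<epsilon> X) p"
definition "phase \<epsilon> X = - (\<nu> + \<epsilon> * defect \<epsilon> X) / \<mu>"

text \<open>The coefficient \<open>a\<close> is replaced by \<open>phase\<close>, the solution of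
  the solvability condition, so the bifurcation equation is part of the map. Carrying the velocity
  as a component of its own lets the iteration run on continuous functions.\<close>

definition "step \<epsilon> X t =
  (phase \<epsilon> X * \<phi> t + u\<^sub>0 t + \<epsilon> * u\<^sub>1 \<epsilon> X t,
   phase \<epsilon> X * \<phi>' t + v\<^sub>0 t + \<epsilon> * v\<^sub>1 \<epsilon> X t,
   w\<^sub>0 t + \<epsilon> * w\<^sub>1 \<epsilon> X t)"

section \<open>Leading response, corrections and the solvability condition\<close>

lemma mu_nonzero: "\<mu> \<noteq> 0"
  using melnikov_simple z0_nonzero by (simp add: \<mu>_def)

lemma continuous_gamma': "continuous_on UNIV (\<lambda>t. 4 * z\<^sub>0 * \<gamma> t)"
  by (intro continuous_intros gamma_continuous)

text \<open>By \<open>melnikov_zero\<close> the leading forcing is already orthogonal to \<phi>, so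
  \<open>u\<^sub>0\<close> solves the linear equation with the full forcing.\<close>

lemma projection_gamma: "projection (\<lambda>t. 4 * z\<^sub>0 * \<gamma> t) = (\<lambda>t. 4 * z\<^sub>0 * \<gamma> t)"
proof (rule projection_eq)
  have "primitive (\<lambda>t. \<phi> t * (4 * z\<^sub>0 * \<gamma> t)) p = primitive (\<lambda>t. (4 * z\<^sub>0) * (\<phi> t * \<gamma> t)) p"
    by (simp add: mult_ac)
  also have "\<dots> = 0"
    by (subst primitive_cmult)
      (auto intro!: continuous_intros continuous_orbit gamma_continuous simp: melnikov_zero)
  finally show "primitive (\<lambda>t. \<phi> t * (4 * z\<^sub>0 * \<gamma> t)) p = 0" .
qed

lemma leading_derivatives:
  "(u\<^sub>0 has_real_derivative v\<^sub>0 t) (at t)"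
  "(v\<^sub>0 has_real_derivative q t * u\<^sub>0 t + 4 * z\<^sub>0 * \<gamma> t) (at t)"
  using green_derivative[OF continuous_gamma', of t] unfolding u\<^sub>0_def v\<^sub>0_def projection_gamma by auto

lemma leading_periodic: "u\<^sub>0 (t + p) = u\<^sub>0 t" "v\<^sub>0 (t + p) = v\<^sub>0 t" "w\<^sub>0 (t + p) = w\<^sub>0 t"
  using green_periodic[OF continuous_gamma'] gamma_periodic
  by (auto simp: u\<^sub>0_def v\<^sub>0_def w\<^sub>0_def orbit_periodic)

lemma continuous_leading: "continuous_on S u\<^sub>0" "continuous_on S v\<^sub>0" "continuous_on S w\<^sub>0"
proof -
  show "continuous_on S u\<^sub>0" "continuous_on S v\<^sub>0"
    by (rule continuous_on_of_derivative leading_derivatives)+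
  thus "continuous_on S w\<^sub>0"
    unfolding w\<^sub>0_def[abs_def] by (intro continuous_intros continuous_orbit) (auto simp: z0_nonzero)
qed

lemmas tame_intros =
  tame_const tame_parameter tame_add tame_diff tame_minus tame_divide tame_mult tame_power2 tame_remainders
  tame_component[where f = fst, OF bounded_linear_fst]
  tame_component[where f = "\<lambda>x. fst (snd x)", OF bounded_linear_compose[OF bounded_linear_fst bounded_linear_snd]]
  tame_component[where f = "\<lambda>x. snd (snd x)", OF bounded_linear_compose[OF bounded_linear_snd bounded_linear_snd]]
  continuous_orbit[THEN tame_fun] continuous_leading[THEN tame_fun] gamma_continuous[THEN tame_fun]

lemma component_le_norm:
  fixes x :: "real \<times> real \<times> real"
  shows "\<bar>fst x\<bar> \<le> norm x" "\<bar>fst (snd x)\<bar> \<le> norm x" "\<bar>snd (snd x)\<bar> \<le> norm x"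
  using norm_fst_le[of "fst x" "snd x"] norm_snd_le[of "snd x" "fst x"]
    norm_fst_le[of "fst (snd x)" "snd (snd x)"] norm_snd_le[of "snd (snd x)" "fst (snd x)"]
  by auto

lemma tame_operators:
  "tame p rem" "tame p forcing" "tame p u\<^sub>1" "tame p v\<^sub>1" "tame p w\<^sub>1" "tame p defect_density"
  "tame p (\<lambda>\<epsilon> X t. defect \<epsilon> X)"
proof -
  show rem: "tame p rem"
    unfolding rem_def[abs_def] by (intro tame_intros component_le_norm)
  show forcing: "tame p forcing"
    unfolding forcing_def[abs_def] by (intro tame_intros rem component_le_norm)
  show u1: "tame p u\<^sub>1" and v1: "tame p v\<^sub>1"
    unfolding u\<^sub>1_def[abs_def] v\<^sub>1_def[abs_def] by (intro tame_green forcing)+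
  show w1: "tame p w\<^sub>1"
    unfolding w\<^sub>1_def[abs_def] level_rem_def by (intro tame_intros u1 v1 component_le_norm)
  show d: "tame p defect_density"
    unfolding defect_density_def[abs_def] by (intro tame_intros u1 w1 rem component_le_norm)
  show "tame p (\<lambda>\<epsilon> X t. defect \<epsilon> X)"
    unfolding defect_def using p_pos by (intro tame_primitive_eval d) auto
qed

lemma continuous_forcing: "continuous_on UNIV X \<Longrightarrow> continuous_on UNIV (forcing \<epsilon> X)"
  by (rule tame_continuous[OF tame_operators(2)])

lemma forcing_periodic: "\<forall>t. X (t + p) = X t \<Longrightarrow> forcing \<epsilon> X (t + p) = forcing \<epsilon> X t"
  by (simp add: forcing_def rem_def orbit_periodic gamma_periodic)

lemma correction_derivatives:
  assumes "continuous_on UNIV X"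
  shows "(u\<^sub>1 \<epsilon> X has_real_derivative v\<^sub>1 \<epsilon> X t) (at t)"
    "(v\<^sub>1 \<epsilon> X has_real_derivative q t * u\<^sub>1 \<epsilon> X t + projection (forcing \<epsilon> X) t) (at t)"
  using green_derivative[OF continuous_forcing[OF assms], of \<epsilon> t] by (auto simp: u\<^sub>1_def v\<^sub>1_def)

lemma correction_periodic:
  assumes "continuous_on UNIV X" "\<forall>t. X (t + p) = X t"
  shows "u\<^sub>1 \<epsilon> X (t + p) = u\<^sub>1 \<epsilon> X t" "v\<^sub>1 \<epsilon> X (t + p) = v\<^sub>1 \<epsilon> X t" "w\<^sub>1 \<epsilon> X (t + p) = w\<^sub>1 \<epsilon> X t"
proof -
  show *: "u\<^sub>1 \<epsilon> X (t + p) = u\<^sub>1 \<epsilon> X t" "v\<^sub>1 \<epsilon> X (t + p) = v\<^sub>1 \<epsilon> X t"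
    using green_periodic[OF continuous_forcing[OF assms(1)] forcing_periodic[OF assms(2)]]
    by (auto simp: u\<^sub>1_def v\<^sub>1_def)
  show "w\<^sub>1 \<epsilon> X (t + p) = w\<^sub>1 \<epsilon> X t"
    using assms(2) by (simp add: w\<^sub>1_def level_rem_def * orbit_periodic)
qed

text \<open>The equation of \<open>u\<^sub>0\<close> is paired with \<open>\<phi>'\<close>, whose
  derivative is \<open>q * \<phi>\<close>. As \<open>\<phi>'\<close> solves the linearised equation
  only up to \<open>- \<phi>\<^sup>2 * \<phi>'\<close>, integrating the derivative of the periodic
  bracket relates this integral to the Melnikov derivative.\<close>

lemma mu_eq: "primitive (\<lambda>t. (\<phi> t)\<^sup>2 * \<phi>' t * u\<^sub>0 t) p = - \<mu>"
proof -
  have c: "continuous_on UNIV (\<lambda>t. (\<phi> t)\<^sup>2 * \<phi>' t * u\<^sub>0 t)"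
    "continuous_on UNIV (\<lambda>t. 4 * z\<^sub>0 * (\<phi>' t * \<gamma> t))"
    "continuous_on UNIV (\<lambda>t. \<phi>' t * \<gamma> t)"
    by (intro continuous_intros continuous_orbit continuous_leading gamma_continuous)+
  have "primitive (\<lambda>t. (\<phi> t)\<^sup>2 * \<phi>' t * u\<^sub>0 t + 4 * z\<^sub>0 * (\<phi>' t * \<gamma> t)) p = 0"
  proof (rule primitive_of_periodic_derivative)
    show "((\<lambda>t. \<phi>' t * v\<^sub>0 t - q t * \<phi> t * u\<^sub>0 t) has_real_derivative
        (\<phi> t)\<^sup>2 * \<phi>' t * u\<^sub>0 t + 4 * z\<^sub>0 * (\<phi>' t * \<gamma> t)) (at t)" for t
      by (rule derivative_eq_intros refl orbit_derivatives leading_derivatives)+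
        (simp add: algebra_simps power2_eq_square)
    show "\<phi>' (t + p) * v\<^sub>0 (t + p) - q (t + p) * \<phi> (t + p) * u\<^sub>0 (t + p)
        = \<phi>' t * v\<^sub>0 t - q t * \<phi> t * u\<^sub>0 t" for t
      by (simp add: orbit_periodic leading_periodic)
  qed (intro continuous_on_add c)
  thus ?thesis
    by (simp add: primitive_add[OF c(1,2)] primitive_cmult[OF c(3)] \<mu>_def)
qed

text \<open>After the square of \<open>u\<close> is expanded, the part quadratic in \<open>a\<close>
  is the exact derivative of \<open>\<phi> ^ 4 / 4\<close> and integrates to zero, and the part
  linear in \<open>a\<close> has slope \<mu> by \<open>mu_eq\<close>.\<close>

lemma solvability_defect:
  assumes "continuous_on UNIV X"
    and u: "\<And>t. fst (X t) = a * \<phi> t + u\<^sub>0 t + \<epsilon> * u\<^sub>1 \<epsilon> X t"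
    and w: "\<And>t. snd (snd (X t)) = w\<^sub>0 t + \<epsilon> * w\<^sub>1 \<epsilon> X t"
  shows "primitive (\<lambda>t. \<phi> t * forcing \<epsilon> X t) p = \<mu> * a + \<nu> + \<epsilon> * defect \<epsilon> X"
proof -
  note ci = continuous_intros continuous_orbit continuous_leading gamma_continuous
  define f1 where "f1 t = \<phi> t * (4 * \<gamma> t * w\<^sub>0 t - \<phi>' t / 2 * (u\<^sub>0 t)\<^sup>2)" for t
  define f2 where "f2 t = (\<phi> t) ^ 3 * \<phi>' t" for t
  define f3 where "f3 t = (\<phi> t)\<^sup>2 * \<phi>' t * u\<^sub>0 t" for t
  have c: "continuous_on UNIV f1" "continuous_on UNIV f2" "continuous_on UNIV f3"
    "continuous_on UNIV (defect_density \<epsilon> X)"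
    unfolding f1_def f2_def f3_def by (intro ci tame_continuous[OF tame_operators(6)] assms(1); simp)+
  have "\<phi> t * forcing \<epsilon> X t
      = f1 t + (- a\<^sup>2 / 2) * f2 t + (- a) * f3 t + \<epsilon> * defect_density \<epsilon> X t" for t
    unfolding forcing_def defect_density_def f1_def f2_def f3_def u w
    by (simp add: field_simps power2_eq_square power3_eq_cube)
  hence "primitive (\<lambda>t. \<phi> t * forcing \<epsilon> X t) p
      = primitive f1 p + (- a\<^sup>2 / 2) * primitive f2 p + (- a) * primitive f3 p + \<epsilon> * defect \<epsilon> X"
    by (simp only: primitive_add primitive_cmult c continuous_on_add continuous_on_mult continuous_on_const
        defect_def)
  moreover have "primitive f2 p = 0"
  proof (rule primitive_of_periodic_derivative)
    show "((\<lambda>t. (\<phi> t) ^ 4 / 4) has_real_derivative f2 t) (at t)" for t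
      unfolding f2_def by (rule DERIV_cdivide derivative_eq_intros refl orbit_derivatives | simp)+
  qed (use c orbit_periodic in auto)
  moreover have "primitive f3 p = - \<mu>"
    using mu_eq by (simp add: f3_def[abs_def])
  moreover have "primitive f1 p = \<nu>"
    by (simp add: f1_def[abs_def] \<nu>_def)
  ultimately show ?thesis
    by (simp add: mult.commute)
qed

section \<open>Periodic orbits on the level set as fixed points\<close>

lemma level_iff:
  assumes "\<epsilon> \<noteq> 0" "X t = (u, v, w)"
  shows "(\<phi> t + \<epsilon> * v)\<^sup>2 / 2 - 4 * c\<^sup>2 * (1 - cos (\<psi>\<^sub>0 t + \<epsilon> * u)) - 2 * (z\<^sub>0 + \<epsilon> * w)\<^sup>2
      = E - 4 * c\<^sup>2 - 2 * z\<^sub>0\<^sup>2 \<longleftrightarrow> w = (\<phi> t * v - \<phi>' t * u + \<epsilon> * level_rem \<epsilon> X t) / (4 * z\<^sub>0)"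
proof -
  define C S where "C = cos_rem \<epsilon> u" and "S = sin_rem \<epsilon> u"
  have "4 * c\<^sup>2 * cos (\<psi>\<^sub>0 t + \<epsilon> * u)
      = q t * (1 - \<epsilon>\<^sup>2 * u\<^sup>2 / 2 + \<epsilon> ^ 3 * C) - \<phi>' t * (\<epsilon> * u + \<epsilon> ^ 3 * S)"
    unfolding sin_cos_shift(2)[OF assms(1)] q_def \<phi>'_def C_def S_def by (simp add: algebra_simps)
  moreover have "level_rem \<epsilon> X t = v\<^sup>2 / 2 + q t * (- u\<^sup>2 / 2 + \<epsilon> * C) - \<epsilon> * \<phi>' t * S - 2 * w\<^sup>2"
    by (simp add: level_rem_def assms(2) C_def S_def)
  moreover have "E = (\<phi> t)\<^sup>2 / 2 + q t"
    using energy[of t] by (simp add: q_def)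
  moreover have "4 * c\<^sup>2 * (1 - cos (\<psi>\<^sub>0 t + \<epsilon> * u)) = 4 * c\<^sup>2 - 4 * c\<^sup>2 * cos (\<psi>\<^sub>0 t + \<epsilon> * u)"
    by (simp add: right_diff_distrib)
  \<comment> \<open>The terms of order zero cancel by the energy identity and a factor \<epsilon>
    remains. Since \<open>level_rem\<close> contains \<open>w\<close> again, the resulting equation
    for \<open>w\<close> is implicit, in the form needed for iteration.\<close>
  ultimately have "((\<phi> t + \<epsilon> * v)\<^sup>2 / 2 - 4 * c\<^sup>2 * (1 - cos (\<psi>\<^sub>0 t + \<epsilon> * u)) - 2 * (z\<^sub>0 + \<epsilon> * w)\<^sup>2)
      - (E - 4 * c\<^sup>2 - 2 * z\<^sub>0\<^sup>2) = \<epsilon> * (\<phi> t * v - \<phi>' t * u + \<epsilon> * level_rem \<epsilon> X t - 4 * z\<^sub>0 * w)"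
    by (simp only:) (simp add: field_simps power2_eq_square power3_eq_cube)
  moreover have "w = (\<phi> t * v - \<phi>' t * u + \<epsilon> * level_rem \<epsilon> X t) / (4 * z\<^sub>0)
      \<longleftrightarrow> \<phi> t * v - \<phi>' t * u + \<epsilon> * level_rem \<epsilon> X t - 4 * z\<^sub>0 * w = 0"
    using z0_nonzero by (auto simp: field_simps)
  ultimately show ?thesis
    using assms(1) by (metis eq_iff_diff_eq_0 mult_eq_0_iff)
qed

lemma force_expansion:
  assumes "\<epsilon> \<noteq> 0" "X t = (u, v, w)"
  shows "4 * (c\<^sup>2 * sin (\<psi>\<^sub>0 t + \<epsilon> * u) + \<epsilon> * \<gamma> t * (z\<^sub>0 + \<epsilon> * w))
    = \<phi>' t + \<epsilon> * (q t * u + (4 * z\<^sub>0 * \<gamma> t + \<epsilon> * forcing \<epsilon> X t))"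
proof -
  have "4 * (c\<^sup>2 * sin (\<psi>\<^sub>0 t + \<epsilon> * u))
      = \<phi>' t * (1 - \<epsilon>\<^sup>2 * u\<^sup>2 / 2 + \<epsilon> ^ 3 * cos_rem \<epsilon> u) + q t * (\<epsilon> * u + \<epsilon> ^ 3 * sin_rem \<epsilon> u)"
    unfolding sin_cos_shift(1)[OF assms(1)] q_def \<phi>'_def by (simp add: algebra_simps)
  thus ?thesis
    by (simp add: forcing_def rem_def assms(2) algebra_simps power2_eq_square power3_eq_cube)
qed

definition "displacement \<epsilon> \<psi> \<psi>' z t = ((\<psi> t - \<psi>\<^sub>0 t) / \<epsilon>, (\<psi>' t - \<phi> t) / \<epsilon>, (z t - z\<^sub>0) / \<epsilon>)"

text \<open>Dividing the difference to the unperturbed orbit by \<epsilon> gives a periodic solution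
  of a forced linear equation. Solvability removes the projection, the kernel supplies
  \<open>a\<close>, the level set supplies \<open>w\<close>, and the solvability condition
  identifies \<open>a\<close> with \<open>phase\<close>.\<close>

lemma step_of_perturbed_orbit:
  assumes "\<epsilon> \<noteq> 0" and orbit: "perturbed_orbit \<epsilon> \<psi> \<psi>' z"
  defines "X \<equiv> displacement \<epsilon> \<psi> \<psi>' z"
  shows "continuous_on UNIV X" "X (t + p) = X t" "step \<epsilon> X = X"
proof -
  define u v w where "u t = (\<psi> t - \<psi>\<^sub>0 t) / \<epsilon>" and "v t = (\<psi>' t - \<phi> t) / \<epsilon>" and "w t = (z t - z\<^sub>0) / \<epsilon>" for t
  have X: "X t = (u t, v t, w t)" for t
    by (simp add: X_def displacement_def u_def v_def w_def)
  have \<psi>: "\<psi> t = \<psi>\<^sub>0 t + \<epsilon> * u t" "\<psi>' t = \<phi> t + \<epsilon> * v t" "z t = z\<^sub>0 + \<epsilon> * w t" for t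
    using assms(1) by (auto simp: u_def v_def w_def)
  have o: "(\<psi> has_real_derivative \<psi>' t) (at t)"
    "(\<psi>' has_real_derivative 4 * (c\<^sup>2 * sin (\<psi> t) + \<epsilon> * \<gamma> t * z t)) (at t)"
    "(z has_real_derivative \<epsilon> * \<gamma> t * \<psi>' t) (at t)"
    "(\<psi>' t)\<^sup>2 / 2 - 4 * c\<^sup>2 * (1 - cos (\<psi> t)) - 2 * (z t)\<^sup>2 = E - 4 * c\<^sup>2 - 2 * z\<^sub>0\<^sup>2"
    "\<psi> (t + p) = \<psi> t" "z (t + p) = z t" for t
    using orbit unfolding perturbed_orbit_def by blast+
  have "continuous_on UNIV \<psi>" "continuous_on UNIV \<psi>'" "continuous_on UNIV z"
    by (rule continuous_on_of_derivative o)+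
  thus cX: "continuous_on UNIV X"
    unfolding X_def displacement_def[abs_def] using assms(1)
    by (intro continuous_intros continuous_orbit) auto
  have u_per: "u (t + p) = u t" for t
    by (simp add: u_def o psi0_periodic)
  show X_per: "X (t + p) = X t" for t
    using derivative_periodic[OF o(1,5)] by (simp add: X_def displacement_def o psi0_periodic orbit_periodic)
  define g where "g t = 4 * z\<^sub>0 * \<gamma> t + \<epsilon> * forcing \<epsilon> X t" for t
  have cg: "continuous_on UNIV g"
    unfolding g_def by (intro continuous_intros gamma_continuous continuous_forcing cX)
  have u': "(u has_real_derivative v t) (at t)" for t
    unfolding u_def[abs_def] v_def by (intro DERIV_cdivide DERIV_diff o psi0_derivative)
  have v': "(v has_real_derivative q t * u t + g t) (at t)" for t
  proof -
    have "(v has_real_derivative (4 * (c\<^sup>2 * sin (\<psi> t) + \<epsilon> * \<gamma> t * z t) - \<phi>' t) / \<epsilon>) (at t)"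
      unfolding v_def[abs_def] by (intro DERIV_cdivide DERIV_diff o orbit_derivatives)
    moreover have "(4 * (c\<^sup>2 * sin (\<psi> t) + \<epsilon> * \<gamma> t * z t) - \<phi>' t) / \<epsilon> = q t * u t + g t"
      unfolding \<psi>(1,3) force_expansion[where X = X, OF assms(1) X] g_def using assms(1) by simp
    ultimately show ?thesis by simp
  qed
  have c: "continuous_on UNIV (\<lambda>t. \<phi> t * \<gamma> t)" "continuous_on UNIV (\<lambda>t. \<phi> t * forcing \<epsilon> X t)"
    by (intro continuous_intros continuous_orbit gamma_continuous continuous_forcing cX)+
  \<comment> \<open>By \<open>melnikov_zero\<close> the leading part of the forcing contributes
    nothing, so a division by \<epsilon> leaves the orthogonality of \<open>forcing\<close>
    itself.\<close>
  have "0 = primitive (\<lambda>t. 4 * z\<^sub>0 * (\<phi> t * \<gamma> t) + \<epsilon> * (\<phi> t * forcing \<epsilon> X t)) p"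
    using solvability[OF u' v' u_per cg] by (simp add: g_def algebra_simps)
  also have "\<dots> = 4 * z\<^sub>0 * primitive (\<lambda>t. \<phi> t * \<gamma> t) p + \<epsilon> * primitive (\<lambda>t. \<phi> t * forcing \<epsilon> X t) p"
    by (simp only: primitive_add primitive_cmult c continuous_on_mult continuous_on_const)
  finally have solv: "primitive (\<lambda>t. \<phi> t * forcing \<epsilon> X t) p = 0"
    using assms(1) by (simp add: melnikov_zero)
  note corr = correction_derivatives[OF cX, of \<epsilon>, unfolded projection_eq[OF solv]]
  obtain a where a: "\<And>t. u t - u\<^sub>0 t - \<epsilon> * u\<^sub>1 \<epsilon> X t = a * \<phi> t" "\<And>t. v t - v\<^sub>0 t - \<epsilon> * v\<^sub>1 \<epsilon> X t = a * \<phi>' t"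
  proof (rule periodic_kernel)
    show "((\<lambda>t. u t - u\<^sub>0 t - \<epsilon> * u\<^sub>1 \<epsilon> X t) has_real_derivative v t - v\<^sub>0 t - \<epsilon> * v\<^sub>1 \<epsilon> X t) (at t)" for t
      by (intro DERIV_diff DERIV_cmult u' leading_derivatives corr)
    show "((\<lambda>t. v t - v\<^sub>0 t - \<epsilon> * v\<^sub>1 \<epsilon> X t) has_real_derivative q t * (u t - u\<^sub>0 t - \<epsilon> * u\<^sub>1 \<epsilon> X t)) (at t)" for t
      by (rule derivative_eq_intros refl v' leading_derivatives corr)+ (simp add: g_def algebra_simps)
    show "u (t + p) - u\<^sub>0 (t + p) - \<epsilon> * u\<^sub>1 \<epsilon> X (t + p) = u t - u\<^sub>0 t - \<epsilon> * u\<^sub>1 \<epsilon> X t" for t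
      using X_per by (simp add: u_per leading_periodic correction_periodic[OF cX])
  qed blast
  have u: "u t = a * \<phi> t + u\<^sub>0 t + \<epsilon> * u\<^sub>1 \<epsilon> X t" and v: "v t = a * \<phi>' t + v\<^sub>0 t + \<epsilon> * v\<^sub>1 \<epsilon> X t" for t
    using a[of t] by linarith+
  have w: "w t = w\<^sub>0 t + \<epsilon> * w\<^sub>1 \<epsilon> X t" for t
  proof -
    have "w t = (\<phi> t * v t - \<phi>' t * u t + \<epsilon> * level_rem \<epsilon> X t) / (4 * z\<^sub>0)"
      using o(4)[of t] unfolding \<psi> level_iff[where X = X, OF assms(1) X] .
    \<comment> \<open>The terms with \<open>a\<close> cancel here.\<close>
    also have "\<phi> t * v t - \<phi>' t * u t + \<epsilon> * level_rem \<epsilon> X t = (\<phi> t * v\<^sub>0 t - \<phi>' t * u\<^sub>0 t)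
        + \<epsilon> * (\<phi> t * v\<^sub>1 \<epsilon> X t - \<phi>' t * u\<^sub>1 \<epsilon> X t + level_rem \<epsilon> X t)"
      unfolding u v by (simp add: algebra_simps)
    finally show ?thesis
      by (simp only: w\<^sub>0_def w\<^sub>1_def add_divide_distrib diff_divide_distrib distrib_left
          right_diff_distrib times_divide_eq_right)
  qed
  have "\<mu> * a + \<nu> + \<epsilon> * defect \<epsilon> X = 0"
    using solvability_defect[OF cX, of a \<epsilon>] solv u w by (simp add: X)
  hence "a = phase \<epsilon> X"
    using mu_nonzero by (simp add: phase_def field_simps)
  thus "step \<epsilon> X = X"
    using u v w by (auto simp: step_def X fun_eq_iff)
qed

text \<open>The choice of \<open>phase\<close> makes the forcing orthogonal to \<phi>, so the
  projection disappears and the equation for \<psi> holds. The fixed point yields the level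
  identity, and the equation for \<open>z\<close> is recovered by differentiating it;
  \<open>small\<close> keeps \<open>z\<close> away from zero.\<close>

lemma perturbed_orbit_of_step:
  assumes "\<epsilon> \<noteq> 0" and ball: "X \<in> periodic_ball p R" and small: "\<bar>\<epsilon>\<bar> * R < \<bar>z\<^sub>0\<bar>" and fp: "step \<epsilon> X = X"
  shows "perturbed_orbit \<epsilon> (\<lambda>t. \<psi>\<^sub>0 t + \<epsilon> * fst (X t)) (\<lambda>t. \<phi> t + \<epsilon> * fst (snd (X t)))
    (\<lambda>t. z\<^sub>0 + \<epsilon> * snd (snd (X t)))"
proof -
  have cX: "continuous_on UNIV X" and X_per: "\<And>t. X (t + p) = X t" and X_le: "\<And>t. norm (X t) \<le> R"
    using ball by (auto simp: periodic_ball_def)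
  define a where "a = phase \<epsilon> X"
  define u v w where "u t = fst (X t)" and "v t = fst (snd (X t))" and "w t = snd (snd (X t))" for t
  have X: "X t = (u t, v t, w t)" for t
    by (simp add: u_def v_def w_def)
  have u: "u t = a * \<phi> t + u\<^sub>0 t + \<epsilon> * u\<^sub>1 \<epsilon> X t" and v: "v t = a * \<phi>' t + v\<^sub>0 t + \<epsilon> * v\<^sub>1 \<epsilon> X t"
    and w: "w t = w\<^sub>0 t + \<epsilon> * w\<^sub>1 \<epsilon> X t" for t
    unfolding u_def v_def w_def a_def by (subst fp[symmetric]; simp add: step_def)+
  have "primitive (\<lambda>t. \<phi> t * forcing \<epsilon> X t) p = \<mu> * a + \<nu> + \<epsilon> * defect \<epsilon> X"
    using solvability_defect[OF cX] u w by (simp add: u_def w_def)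
  also have "\<dots> = 0"
    using mu_nonzero by (simp add: a_def phase_def field_simps)
  finally have solv: "primitive (\<lambda>t. \<phi> t * forcing \<epsilon> X t) p = 0" .
  note corr = correction_derivatives[OF cX, of \<epsilon>, unfolded projection_eq[OF solv]]
  have u': "(u has_real_derivative v t) (at t)" for t
    unfolding u[abs_def] v
    by (rule derivative_eq_intros refl orbit_derivatives leading_derivatives corr)+ simp
  have v': "(v has_real_derivative q t * u t + (4 * z\<^sub>0 * \<gamma> t + \<epsilon> * forcing \<epsilon> X t)) (at t)" for t
    unfolding v[abs_def] u
    by (rule derivative_eq_intros refl orbit_derivatives leading_derivatives corr)+ (simp add: algebra_simps)
  define \<psi> \<psi>' z where "\<psi> t = \<psi>\<^sub>0 t + \<epsilon> * u t" and "\<psi>' t = \<phi> t + \<epsilon> * v t" and "z t = z\<^sub>0 + \<epsilon> * w t" for t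
  define k where "k = E - 4 * c\<^sup>2 - 2 * z\<^sub>0\<^sup>2"
  have d\<psi>: "(\<psi> has_real_derivative \<psi>' t) (at t)" for t
    unfolding \<psi>_def[abs_def] \<psi>'_def by (intro DERIV_add DERIV_cmult psi0_derivative u')
  have d\<psi>': "(\<psi>' has_real_derivative 4 * (c\<^sup>2 * sin (\<psi> t) + \<epsilon> * \<gamma> t * z t)) (at t)" for t
    unfolding \<psi>_def z_def force_expansion[where X = X, OF assms(1) X] \<psi>'_def[abs_def]
    by (intro DERIV_add DERIV_cmult orbit_derivatives v')
  have level: "(\<psi>' t)\<^sup>2 / 2 - 4 * c\<^sup>2 * (1 - cos (\<psi> t)) - 2 * (z t)\<^sup>2 = k" for t
  proof -
    have "w t = (\<phi> t * v t - \<phi>' t * u t + \<epsilon> * level_rem \<epsilon> X t) / (4 * z\<^sub>0)"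
      unfolding w u v w\<^sub>0_def w\<^sub>1_def using z0_nonzero by (simp add: field_simps)
    thus ?thesis
      unfolding \<psi>_def \<psi>'_def z_def k_def level_iff[where X = X, OF assms(1) X] .
  qed
  \<comment> \<open>So far \<open>z\<close> is only known to be continuous. Its differentiability
    comes from writing it as a signed root of \<open>Q\<close>, which depends on \<psi> and
    \<open>\<psi>'\<close> alone.\<close>
  define Q where "Q t = ((\<psi>' t)\<^sup>2 / 2 - 4 * c\<^sup>2 * (1 - cos (\<psi> t)) - k) / 2" for t
  have Q: "Q t = (z t)\<^sup>2" for t
    using level[of t] by (simp add: Q_def)
  have sgn_z: "sgn z\<^sub>0 * z t > 0" for t
  proof -
    have "\<bar>w t\<bar> \<le> R"
      using component_le_norm(3)[of "X t"] X_le[of t] by (simp add: w_def)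
    hence "\<bar>\<epsilon>\<bar> * \<bar>w t\<bar> \<le> \<bar>\<epsilon>\<bar> * R"
      by (intro mult_left_mono) auto
    hence "\<bar>\<epsilon> * w t\<bar> < \<bar>z\<^sub>0\<bar>"
      using small by (simp add: abs_mult)
    thus ?thesis
      using z0_nonzero by (auto simp: z_def sgn_if abs_if split: if_splits)
  qed
  have z_abs: "\<bar>z t\<bar> = sgn z\<^sub>0 * z t" for t
    using sgn_z[of t] z0_nonzero by (auto simp: sgn_if abs_if split: if_splits)
  have z_eq: "z = (\<lambda>t. sgn z\<^sub>0 * sqrt (Q t))"
    using z0_nonzero by (auto simp: fun_eq_iff Q z_abs sgn_if)
  have dz: "(z has_real_derivative \<epsilon> * \<gamma> t * \<psi>' t) (at t)" for t
  proof -
    \<comment> \<open>The conservative parts cancel, and only the coupling term survives.\<close>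
    have "(Q has_real_derivative 2 * \<epsilon> * \<gamma> t * z t * \<psi>' t) (at t)"
      unfolding Q_def[abs_def]
      by (rule DERIV_cdivide derivative_eq_intros refl d\<psi> d\<psi>' | simp add: field_simps)+
    moreover have "Q t > 0"
      using sgn_z[of t] by (auto simp: Q)
    ultimately have "((\<lambda>t. sgn z\<^sub>0 * sqrt (Q t)) has_real_derivative
        sgn z\<^sub>0 * (2 * \<epsilon> * \<gamma> t * z t * \<psi>' t * (inverse (sqrt (Q t)) / 2))) (at t)"
      by (auto intro!: derivative_eq_intros)
    moreover have "sgn z\<^sub>0 * (2 * \<epsilon> * \<gamma> t * z t * \<psi>' t * (inverse (sqrt (Q t)) / 2)) = \<epsilon> * \<gamma> t * \<psi>' t"
      using sgn_z[of t] z0_nonzero by (auto simp: Q z_abs sgn_if field_simps)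
    ultimately have "((\<lambda>t. sgn z\<^sub>0 * sqrt (Q t)) has_real_derivative \<epsilon> * \<gamma> t * \<psi>' t) (at t)"
      by (rule DERIV_cong)
    thus ?thesis
      by (subst z_eq)
  qed
  have "\<psi> (t + p) = \<psi> t" "z (t + p) = z t" for t
    by (simp_all add: \<psi>_def z_def u_def w_def X_per psi0_periodic)
  with d\<psi> d\<psi>' dz level have "perturbed_orbit \<epsilon> \<psi> \<psi>' z"
    unfolding perturbed_orbit_def k_def by blast
  thus ?thesis
    by (simp add: \<psi>_def[abs_def] \<psi>'_def[abs_def] z_def[abs_def] u_def v_def w_def)
qed

text \<open>Nearness is measured in \<psi> and \<open>z\<close> only, whereas uniqueness of the
  fixed point needs a ball for all three components. The equation of motion bounds the second
  derivative of the displacement, and periodicity then bounds the first.\<close>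

lemma velocity_bound:
  assumes "C \<ge> 0"
  obtains M where "M \<ge> 0"
    "\<And>\<epsilon> \<psi> \<psi>' z t. perturbed_orbit \<epsilon> \<psi> \<psi>' z \<Longrightarrow> \<epsilon> \<noteq> 0 \<Longrightarrow> \<bar>\<epsilon>\<bar> \<le> 1 \<Longrightarrow>
      \<forall>t. \<bar>\<psi> t - \<psi>\<^sub>0 t\<bar> \<le> C * \<bar>\<epsilon>\<bar> \<Longrightarrow> \<forall>t. \<bar>z t - z\<^sub>0\<bar> \<le> C * \<bar>\<epsilon>\<bar> \<Longrightarrow> \<bar>\<psi>' t - \<phi> t\<bar> \<le> M * \<bar>\<epsilon>\<bar>"
proof -
  obtain G where G: "G > 0" "\<And>t. \<bar>\<gamma> t\<bar> \<le> G"
    using periodic_continuous_bounded[OF p_pos gamma_continuous gamma_periodic] by metis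
  \<comment> \<open>The first summand comes from the Lipschitz bound on the sine, the second from
    the coupling with \<open>\<bar>z t\<bar> \<le> \<bar>z\<^sub>0\<bar> + C\<close>, valid for
    \<open>\<bar>\<epsilon>\<bar> \<le> 1\<close>.\<close>
  define B where "B = 4 * (c\<^sup>2 * C + G * (\<bar>z\<^sub>0\<bar> + C))"
  have "B \<ge> 0"
    using assms G by (simp add: B_def)
  show ?thesis
  proof (rule that[of "p * B"])
    fix \<epsilon> \<psi> \<psi>' z t
    assume orbit: "perturbed_orbit \<epsilon> \<psi> \<psi>' z" and \<epsilon>: "\<epsilon> \<noteq> 0" "\<bar>\<epsilon>\<bar> \<le> 1"
      and near: "\<forall>t. \<bar>\<psi> t - \<psi>\<^sub>0 t\<bar> \<le> C * \<bar>\<epsilon>\<bar>" "\<forall>t. \<bar>z t - z\<^sub>0\<bar> \<le> C * \<bar>\<epsilon>\<bar>"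
    have o: "(\<psi> has_real_derivative \<psi>' t) (at t)"
      "(\<psi>' has_real_derivative 4 * (c\<^sup>2 * sin (\<psi> t) + \<epsilon> * \<gamma> t * z t)) (at t)" "\<psi> (t + p) = \<psi> t" for t
      using orbit unfolding perturbed_orbit_def by blast+
    have "\<bar>\<psi>' t - \<phi> t\<bar> \<le> p * (B * \<bar>\<epsilon>\<bar>)"
    proof (rule periodic_derivative_bound[OF p_pos, where f' = "\<lambda>t. \<psi>' t - \<phi> t" and t = t])
      show "((\<lambda>t. \<psi> t - \<psi>\<^sub>0 t) has_real_derivative \<psi>' t - \<phi> t) (at t)" for t
        by (intro DERIV_diff o psi0_derivative)
      show "((\<lambda>t. \<psi>' t - \<phi> t) has_real_derivative
          4 * (c\<^sup>2 * (sin (\<psi> t) - sin (\<psi>\<^sub>0 t)) + \<epsilon> * \<gamma> t * z t)) (at t)" for t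
        by (rule derivative_eq_intros refl o phi_derivative)+ (simp add: algebra_simps)
      show "\<psi> (t + p) - \<psi>\<^sub>0 (t + p) = \<psi> t - \<psi>\<^sub>0 t" for t
        by (simp add: o psi0_periodic)
      show "\<bar>4 * (c\<^sup>2 * (sin (\<psi> t) - sin (\<psi>\<^sub>0 t)) + \<epsilon> * \<gamma> t * z t)\<bar> \<le> B * \<bar>\<epsilon>\<bar>" for t
      proof -
        have "\<bar>c\<^sup>2 * (sin (\<psi> t) - sin (\<psi>\<^sub>0 t))\<bar> \<le> c\<^sup>2 * (C * \<bar>\<epsilon>\<bar>)"
          unfolding abs_mult using order_trans[OF sin_lipschitz near(1)[rule_format, of t]]
          by (auto intro: mult_left_mono)
        moreover have "C * \<bar>\<epsilon>\<bar> \<le> C * 1"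
          using assms \<epsilon> by (intro mult_left_mono) auto
        hence "\<bar>z t\<bar> \<le> \<bar>z\<^sub>0\<bar> + C"
          using near(2)[rule_format, of t] by linarith
        hence "\<bar>\<epsilon> * \<gamma> t * z t\<bar> \<le> \<bar>\<epsilon>\<bar> * G * (\<bar>z\<^sub>0\<bar> + C)"
          unfolding abs_mult using G by (intro mult_mono) auto
        ultimately show ?thesis
          by (simp add: B_def abs_le_iff algebra_simps)
      qed
    qed
    thus "\<bar>\<psi>' t - \<phi> t\<bar> \<le> p * B * \<bar>\<epsilon>\<bar>"
      by (simp add: mult.assoc)
  qed (use \<open>B \<ge> 0\<close> p_pos in auto)
qed

section \<open>Contraction, existence and uniqueness\<close>

lemma step_periodic_ball:
  assumes "continuous_on UNIV X" "\<forall>t. X (t + p) = X t"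
  shows "continuous_on UNIV (step \<epsilon> X)" "step \<epsilon> X (t + p) = step \<epsilon> X t"
proof -
  note c = tame_operators(3-5)[THEN tame_continuous, OF assms(1)]
  show "continuous_on UNIV (step \<epsilon> X)"
    unfolding step_def[abs_def] by (intro continuous_intros continuous_orbit continuous_leading c)
  show "step \<epsilon> X (t + p) = step \<epsilon> X t"
    by (simp add: step_def orbit_periodic leading_periodic correction_periodic[OF assms])
qed

lemma norm_triple_le: "norm (x, y, z) \<le> \<bar>x\<bar> + \<bar>y\<bar> + \<bar>z\<bar>" for x y z :: real
  using norm_Pair_le[of x "(y, z)"] norm_Pair_le[of y z] by simp

text \<open>The part of \<open>step\<close> without a factor \<epsilon> is a fixed function
  \<open>b\<close>, so one radius slightly above its bound gives an invariant ball for all small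
  \<epsilon>. The contraction holds on a ball of any radius \<open>R\<close>, as uniqueness
  requires.\<close>

lemma step_contraction:
  obtains R\<^sub>0 where "R\<^sub>0 > 0" "\<And>R. \<exists>\<delta>>0. \<forall>\<epsilon>. \<bar>\<epsilon>\<bar> < \<delta> \<longrightarrow>
    (\<forall>X\<in>periodic_ball p R\<^sub>0. step \<epsilon> X \<in> periodic_ball p R\<^sub>0) \<and>
    (\<forall>X\<in>periodic_ball p R. \<forall>Y\<in>periodic_ball p R. \<forall>D t.
       (\<forall>t. norm (X t - Y t) \<le> D) \<longrightarrow> norm (step \<epsilon> X t - step \<epsilon> Y t) \<le> D / 2)"
proof -
  \<comment> \<open>Splitting \<open>phase\<close> into \<open>- \<nu> / \<mu>\<close> and
    \<open>- \<epsilon> * defect / \<mu>\<close> puts the first term into \<open>b\<close> and the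
    second into \<open>F1\<close> and \<open>F2\<close>.\<close>
  define F1 where "F1 \<epsilon> X t = u\<^sub>1 \<epsilon> X t - defect \<epsilon> X / \<mu> * \<phi> t" for \<epsilon> X t
  define F2 where "F2 \<epsilon> X t = v\<^sub>1 \<epsilon> X t - defect \<epsilon> X / \<mu> * \<phi>' t" for \<epsilon> X t
  define b where "b t = (u\<^sub>0 t - \<nu> / \<mu> * \<phi> t, v\<^sub>0 t - \<nu> / \<mu> * \<phi>' t, w\<^sub>0 t)" for t
  have step_eq: "step \<epsilon> X t = b t + (\<epsilon> * F1 \<epsilon> X t, \<epsilon> * F2 \<epsilon> X t, \<epsilon> * w\<^sub>1 \<epsilon> X t)" for \<epsilon> X t
    using mu_nonzero by (simp add: step_def b_def F1_def F2_def phase_def field_simps)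
  have F: "tame p F1" "tame p F2"
    unfolding F1_def[abs_def] F2_def[abs_def] by (intro tame_intros tame_operators)+
  have "bounded (b ` {0..p})"
    unfolding b_def[abs_def]
    by (intro compact_imp_bounded compact_continuous_image continuous_intros continuous_orbit continuous_leading)
      auto
  then obtain B where B: "B > 0" "\<And>t. t \<in> {0..p} \<Longrightarrow> norm (b t) \<le> B"
    unfolding bounded_pos by auto
  show ?thesis
  proof (rule that[of "B + 1"])
    fix R
    define R' where "R' = max R (B + 1)"
    obtain L1 L2 L3 where L: "0 \<le> L1" "tame_bound p F1 R' L1" "0 \<le> L2" "tame_bound p F2 R' L2"
      "0 \<le> L3" "tame_bound p w\<^sub>1 R' L3"
      using tameE F tame_operators(5) by metis
    define L where "L = L1 + L2 + L3"
    \<comment> \<open>This makes \<open>\<bar>\<epsilon>\<bar> * L\<close> at most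
      \<open>1 / 2\<close>, for invariance and contraction alike, and keeps
      \<open>\<bar>\<epsilon>\<bar> \<le> 1\<close> as \<open>tame_bound\<close> demands.\<close>
    define \<delta> where "\<delta> = 1 / (2 * L + 1)"
    have \<delta>: "\<delta> > 0" "\<delta> \<le> 1"
      using L by (auto simp: \<delta>_def L_def)
    have sub: "periodic_ball p (B + 1) \<subseteq> periodic_ball p R'" "periodic_ball p R \<subseteq> periodic_ball p R'"
      by (auto simp: R'_def intro!: periodic_ball_mono)
    have est: "norm (step \<epsilon> X t) \<le> B + 1" "norm (step \<epsilon> X t - step \<epsilon> Y t) \<le> D / 2"
      if \<epsilon>: "\<bar>\<epsilon>\<bar> < \<delta>" and X: "X \<in> periodic_ball p R'" and Y: "Y \<in> periodic_ball p R'"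
        and D: "\<forall>t. norm (X t - Y t) \<le> D" for \<epsilon> X Y D t
    proof -
      have hX: "continuous_on UNIV X" "\<forall>t. X (t + p) = X t" "\<forall>t. norm (X t) \<le> R'"
        and hY: "continuous_on UNIV Y" "\<forall>t. Y (t + p) = Y t" "\<forall>t. norm (Y t) \<le> R'"
        using X Y by (auto simp: periodic_ball_def)
      \<comment> \<open>The bounds from \<open>tame_bound\<close> hold on \<open>{0..p}\<close>
        only; both images are moved to the same point there.\<close>
      obtain r where r: "r \<in> {0..p}" "step \<epsilon> X t = step \<epsilon> X r" "step \<epsilon> Y t = step \<epsilon> Y r"
        using periodic_representative[OF p_pos, of t] step_periodic_ball(2)[OF hX(1,2)]
          step_periodic_ball(2)[OF hY(1,2)] by metis
      have "\<bar>\<epsilon>\<bar> \<le> 1"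
        using \<epsilon> \<delta> by simp
      note bd = tame_boundD[OF _ this hX(1) hY(1) hX(3) hY(3) D r(1)]
      have "D \<ge> 0"
        using D norm_ge_zero order_trans by blast
      have "\<bar>\<epsilon>\<bar> * L \<le> \<delta> * L"
        using \<epsilon> L by (intro mult_right_mono) (auto simp: L_def)
      also have "\<dots> \<le> 1 / 2"
        using L by (simp add: \<delta>_def L_def field_simps)
      finally have \<epsilon>L: "\<bar>\<epsilon>\<bar> * L \<le> 1 / 2" .
      have "norm (\<epsilon> * F1 \<epsilon> X r, \<epsilon> * F2 \<epsilon> X r, \<epsilon> * w\<^sub>1 \<epsilon> X r)
          \<le> \<bar>\<epsilon>\<bar> * (\<bar>F1 \<epsilon> X r\<bar> + \<bar>F2 \<epsilon> X r\<bar> + \<bar>w\<^sub>1 \<epsilon> X r\<bar>)"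
        using norm_triple_le[of "\<epsilon> * F1 \<epsilon> X r" "\<epsilon> * F2 \<epsilon> X r" "\<epsilon> * w\<^sub>1 \<epsilon> X r"]
        by (simp add: abs_mult distrib_left)
      also have "\<dots> \<le> \<bar>\<epsilon>\<bar> * L"
        unfolding L_def by (intro mult_left_mono add_mono bd(1)[OF L(2)] bd(1)[OF L(4)] bd(1)[OF L(6)]) auto
      finally have "norm (step \<epsilon> X r) \<le> B + 1 / 2"
        unfolding step_eq using \<epsilon>L B(2)[OF r(1)] norm_triangle_ineq order_trans add_mono by smt
      thus "norm (step \<epsilon> X t) \<le> B + 1"
        unfolding r(2) by simp
      have "step \<epsilon> X r - step \<epsilon> Y r = (\<epsilon> * (F1 \<epsilon> X r - F1 \<epsilon> Y r), \<epsilon> * (F2 \<epsilon> X r - F2 \<epsilon> Y r),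
          \<epsilon> * (w\<^sub>1 \<epsilon> X r - w\<^sub>1 \<epsilon> Y r))"
        unfolding step_eq by (simp add: algebra_simps)
      hence "norm (step \<epsilon> X r - step \<epsilon> Y r)
          \<le> \<bar>\<epsilon>\<bar> * (\<bar>F1 \<epsilon> X r - F1 \<epsilon> Y r\<bar> + \<bar>F2 \<epsilon> X r - F2 \<epsilon> Y r\<bar> + \<bar>w\<^sub>1 \<epsilon> X r - w\<^sub>1 \<epsilon> Y r\<bar>)"
        using norm_triple_le[of "\<epsilon> * (F1 \<epsilon> X r - F1 \<epsilon> Y r)" "\<epsilon> * (F2 \<epsilon> X r - F2 \<epsilon> Y r)"
            "\<epsilon> * (w\<^sub>1 \<epsilon> X r - w\<^sub>1 \<epsilon> Y r)"]
        by (simp only: abs_mult distrib_left)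
      also have "\<dots> \<le> \<bar>\<epsilon>\<bar> * (L1 * D + L2 * D + L3 * D)"
        by (intro mult_left_mono add_mono bd(3)[OF L(2)] bd(3)[OF L(4)] bd(3)[OF L(6)]) auto
      also have "\<dots> = \<bar>\<epsilon>\<bar> * L * D"
        by (simp add: L_def algebra_simps)
      also have "\<dots> \<le> 1 / 2 * D"
        using \<epsilon>L \<open>D \<ge> 0\<close> by (intro mult_right_mono)
      finally show "norm (step \<epsilon> X t - step \<epsilon> Y t) \<le> D / 2"
        unfolding r(2,3) by simp
    qed
    show "\<exists>\<delta>>0. \<forall>\<epsilon>. \<bar>\<epsilon>\<bar> < \<delta> \<longrightarrow>
      (\<forall>X\<in>periodic_ball p (B + 1). step \<epsilon> X \<in> periodic_ball p (B + 1)) \<and>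
      (\<forall>X\<in>periodic_ball p R. \<forall>Y\<in>periodic_ball p R. \<forall>D t.
         (\<forall>t. norm (X t - Y t) \<le> D) \<longrightarrow> norm (step \<epsilon> X t - step \<epsilon> Y t) \<le> D / 2)"
    proof (intro exI[of _ \<delta>] conjI allI impI ballI \<delta>)
      fix \<epsilon> :: real and X :: "real \<Rightarrow> real \<times> real \<times> real"
      assume "\<bar>\<epsilon>\<bar> < \<delta>" "X \<in> periodic_ball p (B + 1)"
      thus "step \<epsilon> X \<in> periodic_ball p (B + 1)"
        using est(1)[of \<epsilon> X X 0] sub(1) step_periodic_ball[of X \<epsilon>] by (auto simp: periodic_ball_def)
    next
      fix \<epsilon> D t :: real and X Y :: "real \<Rightarrow> real \<times> real \<times> real"
      assume "\<bar>\<epsilon>\<bar> < \<delta>" "X \<in> periodic_ball p R" "Y \<in> periodic_ball p R"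
        "\<forall>t. norm (X t - Y t) \<le> D"
      thus "norm (step \<epsilon> X t - step \<epsilon> Y t) \<le> D / 2"
        using est(2) sub(2) by blast
    qed
  qed (use B in auto)
qed

text \<open>Existence comes from the ball of radius \<open>R\<^sub>0\<close>, and
  \<open>C \<ge> R\<^sub>0\<close> turns that radius into nearness. Any near orbit has its
  displacement in the larger ball of radius \<open>R\<close>, where fixed points are unique.\<close>

theorem unique_nearby_perturbed_orbit:
  "\<exists>C\<^sub>0>0. \<forall>C\<ge>C\<^sub>0. \<exists>\<delta>>0. \<forall>\<epsilon>. 0 < \<bar>\<epsilon>\<bar> \<and> \<bar>\<epsilon>\<bar> < \<delta> \<longrightarrow>
     (\<exists>!(\<psi>, z). (\<exists>\<psi>'. perturbed_orbit \<epsilon> \<psi> \<psi>' z) \<and> (\<forall>t. norm (\<psi> t - \<psi>\<^sub>0 t, z t - z\<^sub>0) \<le> C * \<bar>\<epsilon>\<bar>))"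
proof -
  obtain R\<^sub>0 where "R\<^sub>0 > 0" and contr: "\<And>R. \<exists>\<delta>>0. \<forall>\<epsilon>. \<bar>\<epsilon>\<bar> < \<delta> \<longrightarrow>
    (\<forall>X\<in>periodic_ball p R\<^sub>0. step \<epsilon> X \<in> periodic_ball p R\<^sub>0) \<and>
    (\<forall>X\<in>periodic_ball p R. \<forall>Y\<in>periodic_ball p R. \<forall>D t.
       (\<forall>t. norm (X t - Y t) \<le> D) \<longrightarrow> norm (step \<epsilon> X t - step \<epsilon> Y t) \<le> D / 2)"
    using step_contraction by blast
  show ?thesis
  proof (rule exI[of _ R\<^sub>0], intro conjI allI impI \<open>R\<^sub>0 > 0\<close>)
    fix C assume C: "C \<ge> R\<^sub>0"
    hence "C \<ge> 0"
      using \<open>R\<^sub>0 > 0\<close> by simp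
    then obtain M where M: "M \<ge> 0"
      "\<And>\<epsilon> \<psi> \<psi>' z t. perturbed_orbit \<epsilon> \<psi> \<psi>' z \<Longrightarrow> \<epsilon> \<noteq> 0 \<Longrightarrow> \<bar>\<epsilon>\<bar> \<le> 1 \<Longrightarrow>
        \<forall>t. \<bar>\<psi> t - \<psi>\<^sub>0 t\<bar> \<le> C * \<bar>\<epsilon>\<bar> \<Longrightarrow> \<forall>t. \<bar>z t - z\<^sub>0\<bar> \<le> C * \<bar>\<epsilon>\<bar> \<Longrightarrow> \<bar>\<psi>' t - \<phi> t\<bar> \<le> M * \<bar>\<epsilon>\<bar>"
      by (rule velocity_bound) (erule that, blast)
    \<comment> \<open>The summands bound the displacements of \<psi>, of its velocity and of
      \<open>z\<close>.\<close>
    define R where "R = C + M + C"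
    have "R \<ge> R\<^sub>0"
      using C M(1) \<open>R\<^sub>0 > 0\<close> by (simp add: R_def)
    hence sub: "periodic_ball p R\<^sub>0 \<subseteq> periodic_ball p R"
      by (rule periodic_ball_mono)
    obtain \<delta>' where "\<delta>' > 0" and \<delta>': "\<forall>\<epsilon>. \<bar>\<epsilon>\<bar> < \<delta>' \<longrightarrow>
      (\<forall>X\<in>periodic_ball p R\<^sub>0. step \<epsilon> X \<in> periodic_ball p R\<^sub>0) \<and>
      (\<forall>X\<in>periodic_ball p R. \<forall>Y\<in>periodic_ball p R. \<forall>D t.
         (\<forall>t. norm (X t - Y t) \<le> D) \<longrightarrow> norm (step \<epsilon> X t - step \<epsilon> Y t) \<le> D / 2)"
      using contr[of R] by blast
    \<comment> \<open>The three bounds serve the contraction, the velocity bound and the sign of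
      \<open>z\<close>, in this order.\<close>
    define \<delta> where "\<delta> = min (min \<delta>' 1) (\<bar>z\<^sub>0\<bar> / R\<^sub>0)"
    show "\<exists>\<delta>>0. \<forall>\<epsilon>. 0 < \<bar>\<epsilon>\<bar> \<and> \<bar>\<epsilon>\<bar> < \<delta> \<longrightarrow>
      (\<exists>!(\<psi>, z). (\<exists>\<psi>'. perturbed_orbit \<epsilon> \<psi> \<psi>' z) \<and> (\<forall>t. norm (\<psi> t - \<psi>\<^sub>0 t, z t - z\<^sub>0) \<le> C * \<bar>\<epsilon>\<bar>))"
    proof (intro exI[of _ \<delta>] conjI allI impI)
      show "\<delta> > 0"
        using \<open>\<delta>' > 0\<close> \<open>R\<^sub>0 > 0\<close> z0_nonzero by (simp add: \<delta>_def)
      fix \<epsilon> assume "0 < \<bar>\<epsilon>\<bar> \<and> \<bar>\<epsilon>\<bar> < \<delta>"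
      hence \<epsilon>: "\<epsilon> \<noteq> 0" "\<bar>\<epsilon>\<bar> \<le> 1" "\<bar>\<epsilon>\<bar> < \<delta>'" "\<bar>\<epsilon>\<bar> < \<bar>z\<^sub>0\<bar> / R\<^sub>0"
        by (auto simp: \<delta>_def)
      note self = \<delta>'[rule_format, OF \<epsilon>(3), THEN conjunct1, rule_format]
      note lip = \<delta>'[rule_format, OF \<epsilon>(3), THEN conjunct2, rule_format]
      obtain X where X: "X \<in> periodic_ball p R\<^sub>0" "step \<epsilon> X = X"
      proof -
        have "\<exists>X\<in>periodic_ball p R\<^sub>0. step \<epsilon> X = X"
        proof (rule periodic_ball_fixpoint)
          show "norm (step \<epsilon> X t - step \<epsilon> Y t) \<le> D / 2"
            if "X \<in> periodic_ball p R\<^sub>0" "Y \<in> periodic_ball p R\<^sub>0" "\<forall>t. norm (X t - Y t) \<le> D" for X Y D t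
            using lip[of X Y D t] that sub by blast
        qed (use \<open>R\<^sub>0 > 0\<close> self in auto)
        thus ?thesis using that by blast
      qed
      define \<psi> z where "\<psi> t = \<psi>\<^sub>0 t + \<epsilon> * fst (X t)" and "z t = z\<^sub>0 + \<epsilon> * snd (snd (X t))" for t
      have orbit: "perturbed_orbit \<epsilon> \<psi> (\<lambda>t. \<phi> t + \<epsilon> * fst (snd (X t))) z"
        unfolding \<psi>_def[abs_def] z_def[abs_def] using \<epsilon>(4) \<open>R\<^sub>0 > 0\<close>
        by (intro perturbed_orbit_of_step[OF \<epsilon>(1) X(1) _ X(2)]) (simp add: field_simps)
      have near: "norm (\<psi> t - \<psi>\<^sub>0 t, z t - z\<^sub>0) \<le> C * \<bar>\<epsilon>\<bar>" for t
      proof -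
        have "(\<psi> t - \<psi>\<^sub>0 t, z t - z\<^sub>0) = \<epsilon> *\<^sub>R (fst (X t), snd (snd (X t)))"
          by (simp add: \<psi>_def z_def)
        also have "norm \<dots> \<le> \<bar>\<epsilon>\<bar> * norm (X t)"
          unfolding norm_scaleR
          by (intro mult_left_mono) (cases "X t", auto simp: norm_Pair)
        also have "\<dots> \<le> \<bar>\<epsilon>\<bar> * C"
          using X(1) C by (intro mult_left_mono) (auto simp: periodic_ball_def intro: order_trans)
        finally show ?thesis by (simp add: mult.commute)
      qed
      have ball: "displacement \<epsilon> \<psi> \<psi>' z \<in> periodic_ball p R"
        if o: "perturbed_orbit \<epsilon> \<psi> \<psi>' z" and n: "\<forall>t. norm (\<psi> t - \<psi>\<^sub>0 t, z t - z\<^sub>0) \<le> C * \<bar>\<epsilon>\<bar>" for \<psi> \<psi>' z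
      proof -
        have n': "\<bar>\<psi> t - \<psi>\<^sub>0 t\<bar> \<le> C * \<bar>\<epsilon>\<bar>" "\<bar>z t - z\<^sub>0\<bar> \<le> C * \<bar>\<epsilon>\<bar>" for t
          using n[rule_format, of t] norm_fst_le[of "\<psi> t - \<psi>\<^sub>0 t" "z t - z\<^sub>0"]
            norm_snd_le[of "z t - z\<^sub>0" "\<psi> t - \<psi>\<^sub>0 t"] by auto
        have "norm (displacement \<epsilon> \<psi> \<psi>' z t) \<le> R" for t
        proof -
          have "\<bar>\<psi>' t - \<phi> t\<bar> \<le> M * \<bar>\<epsilon>\<bar>"
            using M(2)[OF o \<epsilon>(1,2)] n' by blast
          with n'[of t] \<epsilon>(1) have "\<bar>(\<psi> t - \<psi>\<^sub>0 t) / \<epsilon>\<bar> \<le> C" "\<bar>(\<psi>' t - \<phi> t) / \<epsilon>\<bar> \<le> M" "\<bar>(z t - z\<^sub>0) / \<epsilon>\<bar> \<le> C"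
            by (simp_all add: divide_le_eq)
          thus ?thesis
            unfolding displacement_def R_def by (intro order_trans[OF norm_triple_le] add_mono)
        qed
        thus ?thesis
          using step_of_perturbed_orbit[OF \<epsilon>(1) o] by (simp add: periodic_ball_def)
      qed
      show "\<exists>!(\<psi>, z). (\<exists>\<psi>'. perturbed_orbit \<epsilon> \<psi> \<psi>' z) \<and> (\<forall>t. norm (\<psi> t - \<psi>\<^sub>0 t, z t - z\<^sub>0) \<le> C * \<bar>\<epsilon>\<bar>)"
      proof (rule ex1I[of _ "(\<psi>, z)"])
        show "case (\<psi>, z) of (\<psi>, z) \<Rightarrow> (\<exists>\<psi>'. perturbed_orbit \<epsilon> \<psi> \<psi>' z) \<and>
            (\<forall>t. norm (\<psi> t - \<psi>\<^sub>0 t, z t - z\<^sub>0) \<le> C * \<bar>\<epsilon>\<bar>)"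
          using orbit near by auto
        fix w assume w: "case w of (\<psi>, z) \<Rightarrow> (\<exists>\<psi>'. perturbed_orbit \<epsilon> \<psi> \<psi>' z) \<and>
            (\<forall>t. norm (\<psi> t - \<psi>\<^sub>0 t, z t - z\<^sub>0) \<le> C * \<bar>\<epsilon>\<bar>)"
        obtain \<psi>2 z2 where w_eq: "w = (\<psi>2, z2)" by (cases w)
        then obtain \<psi>2' where o2: "perturbed_orbit \<epsilon> \<psi>2 \<psi>2' z2"
          and n2: "\<forall>t. norm (\<psi>2 t - \<psi>\<^sub>0 t, z2 t - z\<^sub>0) \<le> C * \<bar>\<epsilon>\<bar>"
          using w by auto
        have eq: "displacement \<epsilon> \<psi>2 \<psi>2' z2 = X"
        proof (rule periodic_ball_unique_fixpoint[where T = "step \<epsilon>"])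
          show "displacement \<epsilon> \<psi>2 \<psi>2' z2 \<in> periodic_ball p R" "X \<in> periodic_ball p R"
            using ball[OF o2 n2] X(1) sub by auto
          thus "norm (step \<epsilon> (displacement \<epsilon> \<psi>2 \<psi>2' z2) t - step \<epsilon> X t) \<le> D / 2"
            if "\<forall>t. norm (displacement \<epsilon> \<psi>2 \<psi>2' z2 t - X t) \<le> D" for D t
            using lip that by blast
        qed (use step_of_perturbed_orbit[OF \<epsilon>(1) o2] X(2) in auto)
        have "X t = ((\<psi>2 t - \<psi>\<^sub>0 t) / \<epsilon>, (\<psi>2' t - \<phi> t) / \<epsilon>, (z2 t - z\<^sub>0) / \<epsilon>)" for t
          using fun_cong[OF eq, of t] by (simp add: displacement_def)
        thus "w = (\<psi>, z)"
          using \<epsilon>(1) by (simp add: w_eq \<psi>_def z_def fun_eq_iff)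
      qed
    qed
  qed
qed

end

section \<open>The unperturbed pendulum orbit\<close>

context
  fixes k :: real
  assumes k: "0 < k" "k < 1"
begin

lemma elliptic_F_am: "elliptic_F k (jacobi_am u k) = u"
  unfolding jacobi_am_def by (rule theI'[OF elliptic_F_ex1[OF k]])

lemma am_eqI: "elliptic_F k x = u \<Longrightarrow> jacobi_am u k = x"
  using elliptic_F_ex1[OF k, of u] elliptic_F_am[of u] by blast

lemma elliptic_F_0: "elliptic_F k 0 = 0"
  by (simp add: elliptic_F_def flip: zero_ereal_def)

text \<open>The inverse function rule for \<open>elliptic_F k\<close>; the derivative is Jacobi's
  dn.\<close>

lemma am_derivative:
  "((\<lambda>u. jacobi_am u k) has_real_derivative sqrt (1 - k\<^sup>2 * (sin (jacobi_am u k))\<^sup>2)) (at u)"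
proof -
  have "isCont (\<lambda>u. jacobi_am u k) (elliptic_F k (jacobi_am u k))"
    by (rule isCont_inverse_function2[where a = "jacobi_am u k - 1" and b = "jacobi_am u k + 1"])
      (auto intro: am_eqI DERIV_isCont[OF elliptic_F_deriv[OF k]])
  hence "((\<lambda>u. jacobi_am u k) has_real_derivative
      inverse (1 / sqrt (1 - k\<^sup>2 * (sin (jacobi_am u k))\<^sup>2))) (at u)"
    using elliptic_F_radicand[OF k, of "jacobi_am u k"]
    by (intro DERIV_inverse_function[where f = "elliptic_F k" and a = "u - 1" and b = "u + 1"]
        elliptic_F_deriv k) (auto simp: elliptic_F_am)
  thus ?thesis by simp
qed

text \<open>The integrand has period \<open>pi\<close>, so the increment is the constant
  \<open>elliptic_F k pi\<close>. Evaluating at \<open>- pi / 2\<close> and using that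
  \<open>elliptic_F k\<close> is odd gives its value.\<close>

lemma elliptic_F_add_pi: "elliptic_F k (x + pi) = elliptic_F k x + 2 * elliptic_K k"
proof -
  let ?f = "\<lambda>x. 1 / sqrt (1 - k\<^sup>2 * (sin x)\<^sup>2)"
  have "((\<lambda>x. elliptic_F k (x + pi)) has_real_derivative ?f x) (at x)" for x
    using elliptic_F_deriv[OF k, of "x + pi"] by (simp add: DERIV_shift)
  from eq_of_derivative_eq[OF this elliptic_F_deriv[OF k]]
  have shift: "elliptic_F k (x + pi) = elliptic_F k x + elliptic_F k pi" for x
    using elliptic_F_0 by (metis add.commute add_0 diff_0_right diff_eq_eq)
  have "((\<lambda>x. - elliptic_F k (- x)) has_real_derivative ?f x) (at x)" for x
    using DERIV_minus[OF DERIV_chain2[OF elliptic_F_deriv[OF k] DERIV_minus[OF DERIV_ident]], of x]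
    by simp
  from eq_of_derivative_eq[OF this elliptic_F_deriv[OF k], of "pi / 2" 0]
  have "elliptic_F k (- (pi / 2)) = - elliptic_K k"
    by (simp add: elliptic_F_0 elliptic_K_def)
  hence "elliptic_F k pi = 2 * elliptic_K k"
    using shift[of "- (pi / 2)"] by (simp add: elliptic_K_def)
  thus ?thesis by (simp add: shift)
qed

lemma am_shift: "jacobi_am (u + 2 * real n * elliptic_K k) k = jacobi_am u k + real n * pi"
proof (induction n)
  case (Suc n)
  have "elliptic_F k (jacobi_am u k + real n * pi + pi) = u + 2 * real n * elliptic_K k + 2 * elliptic_K k"
    unfolding elliptic_F_add_pi Suc[symmetric] elliptic_F_am ..
  thus ?case
    by (intro am_eqI) (simp add: algebra_simps)
qed simp

text \<open>Since \<open>k < 1\<close>, the argument of \<open>arcsin\<close> stays strictly inside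
  its domain, and the root from its derivative cancels the dn from the amplitude, which leaves a
  multiple of cn.\<close>

lemma psi_kc_orbit:
  assumes "p > 0" "c > 0" "elliptic_K k = c * p / (2 * real q)" "q > 0"
  shows "pendulum_orbit c p (4 * c\<^sup>2 * (2 * k\<^sup>2 - 1)) (\<lambda>t. psi_kc k c (t - a))
    (\<lambda>t. 4 * c * k * jacobi_cn (2 * c * (t - a)) k)"
proof
  fix t
  let ?m = "\<lambda>t. jacobi_am (2 * c * (t - a)) k"
  let ?x = "k * sin (?m t)"
  have rad: "0 < 1 - k\<^sup>2 * (sin (?m t))\<^sup>2"
    by (rule elliptic_F_radicand[OF k])
  hence "\<bar>?x\<bar>\<^sup>2 < 1\<^sup>2"
    by (simp add: power_mult_distrib)
  hence "\<bar>?x\<bar> < 1"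
    by (rule power2_less_imp_less) simp
  hence x: "-1 < ?x" "?x < 1"
    by auto
  have am: "(?m has_real_derivative sqrt (1 - k\<^sup>2 * (sin (?m t))\<^sup>2) * (2 * c)) (at t)"
    by (rule DERIV_chain2[OF am_derivative]) (auto intro!: derivative_eq_intros)
  have psi: "psi_kc k c (t - a) = pi + 2 * arcsin (k * sin (?m t))" for t
    by (simp add: psi_kc_def jacobi_sn_def)
  have sin_psi: "sin (psi_kc k c (t - a)) = - (2 * ?x * sqrt (1 - k\<^sup>2 * (sin (?m t))\<^sup>2))"
    using x by (simp add: psi sin_add sin_double cos_arcsin power_mult_distrib)
  have "((\<lambda>t. arcsin (k * sin (?m t))) has_real_derivative inverse (sqrt (1 - ?x\<^sup>2)) *
      (k * (cos (?m t) * (sqrt (1 - k\<^sup>2 * (sin (?m t))\<^sup>2) * (2 * c))))) (at t)"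
    by (rule DERIV_chain2[where f = arcsin and g = "\<lambda>t. k * sin (?m t)", OF DERIV_arcsin[OF x]])
      (intro DERIV_cmult DERIV_chain2[OF DERIV_sin am])
  from DERIV_add[OF DERIV_const[of pi] DERIV_cmult[OF this, of 2]]
  show "((\<lambda>t. psi_kc k c (t - a)) has_real_derivative 4 * c * k * jacobi_cn (2 * c * (t - a)) k) (at t)"
    unfolding psi using rad by (simp add: jacobi_cn_def power_mult_distrib field_simps)
  have "((\<lambda>t. 4 * c * k * cos (?m t)) has_real_derivative
      4 * c * k * (- sin (?m t) * (sqrt (1 - k\<^sup>2 * (sin (?m t))\<^sup>2) * (2 * c)))) (at t)"
    by (intro DERIV_cmult DERIV_chain2[OF DERIV_cos am])
  thus "((\<lambda>t. 4 * c * k * jacobi_cn (2 * c * (t - a)) k) has_real_derivative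
      4 * c\<^sup>2 * sin (psi_kc k c (t - a))) (at t)"
    unfolding jacobi_cn_def sin_psi by (simp add: algebra_simps power2_eq_square)
  have cos_psi: "cos (psi_kc k c (t - a)) = - (1 - 2 * ?x\<^sup>2)"
    using x by (simp add: psi cos_add cos_double_sin)
  have cn: "(cos (?m t))\<^sup>2 = 1 - (sin (?m t))\<^sup>2"
    by (simp add: cos_squared_eq)
  show "(4 * c * k * jacobi_cn (2 * c * (t - a)) k)\<^sup>2 / 2 + 4 * c\<^sup>2 * cos (psi_kc k c (t - a))
      = 4 * c\<^sup>2 * (2 * k\<^sup>2 - 1)"
    unfolding jacobi_cn_def power_mult_distrib cn cos_psi by (simp add: field_simps)
  \<comment> \<open>The assumption on \<open>elliptic_K k\<close> makes a shift by \<open>p\<close>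
    advance the amplitude by \<open>2 * q * pi\<close>, that is, by \<open>q\<close> full turns of
    the sine.\<close>
  have "2 * c * (t + p - a) = 2 * c * (t - a) + 2 * real (2 * q) * elliptic_K k"
    using assms by (simp add: field_simps)
  hence "?m (t + p) = ?m t + 2 * real q * pi"
    using am_shift[of "2 * c * (t - a)" "2 * q"] by (simp add: mult_ac)
  moreover have "sin (x + 2 * real q * pi) = sin x" for x
    using sin.plus_of_nat[of x q] by (simp add: mult_ac)
  ultimately show "psi_kc k c (t + p - a) = psi_kc k c (t - a)"
    by (simp add: psi)
next
  have "k\<^sup>2 < 1"
    using k by (simp add: power_less_one_iff)
  hence "64 * c ^ 4 * k\<^sup>2 * (k\<^sup>2 - 1) \<noteq> 0"
    using k assms by simp
  moreover have "(4 * c\<^sup>2 * (2 * k\<^sup>2 - 1))\<^sup>2 - 16 * c ^ 4 = 64 * c ^ 4 * k\<^sup>2 * (k\<^sup>2 - 1)"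
    by (simp add: power2_eq_square power4_eq_xxxx algebra_simps)
  ultimately show "(4 * c\<^sup>2 * (2 * k\<^sup>2 - 1))\<^sup>2 \<noteq> 16 * c ^ 4"
    by auto
qed (use assms in auto)

end

section \<open>Transfer to the original formulation\<close>

lemma C2_fun_derivative:
  assumes "C2_fun \<gamma>"
  shows "(\<gamma> has_real_derivative deriv \<gamma> t) (at t)" "continuous_on UNIV \<gamma>" "continuous_on UNIV (deriv \<gamma>)"
proof -
  have d: "(f has_real_derivative deriv f t) (at t)" if "f C1_differentiable_on UNIV" for f :: "real \<Rightarrow> real" and t
    using that unfolding C1_differentiable_on_def
    by (metis UNIV_I DERIV_imp_deriv has_real_derivative_iff_has_vector_derivative)
  show "(\<gamma> has_real_derivative deriv \<gamma> t) (at t)"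
    using d assms by (auto simp: C2_fun_def)
  show "continuous_on UNIV \<gamma>" "continuous_on UNIV (deriv \<gamma>)"
    using continuous_on_of_derivative[OF d] assms by (auto simp: C2_fun_def)
qed

lemma near_solutions_iff:
  assumes "perturbed_pendulum c (real p) (4 * c\<^sup>2 * (2 * k\<^sup>2 - 1)) (\<lambda>t. psi_kc k c (t - \<alpha>\<^sub>0))
    (\<lambda>t. 4 * c * k * jacobi_cn (2 * c * (t - \<alpha>\<^sub>0)) k) z\<^sub>0 \<gamma>"
    and "z\<^sub>0 = s * sqrt (- 4 * c\<^sup>2 * (1 - k\<^sup>2) - d / 2)" "z\<^sub>0\<^sup>2 = - 4 * c\<^sup>2 * (1 - k\<^sup>2) - d / 2"
  shows "(\<psi>, z) \<in> near_solutions k c d \<gamma> p \<alpha>\<^sub>0 \<epsilon> s r \<longleftrightarrow>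
    (\<exists>\<psi>'. perturbed_pendulum.perturbed_orbit c (real p) (4 * c\<^sup>2 * (2 * k\<^sup>2 - 1)) z\<^sub>0 \<gamma> \<epsilon> \<psi> \<psi>' z) \<and>
    (\<forall>t. norm (\<psi> t - psi_kc k c (t - \<alpha>\<^sub>0), z t - z\<^sub>0) \<le> r)"
proof -
  \<comment> \<open>This identity dictates the constant in the leading term.\<close>
  have level: "4 * c\<^sup>2 * (2 * k\<^sup>2 - 1) - 4 * c\<^sup>2 - 2 * z\<^sub>0\<^sup>2 = d"
    by (simp add: assms(3) algebra_simps)
  have "(\<exists>\<psi>'. perturbed_pendulum.perturbed_orbit c (real p) (4 * c\<^sup>2 * (2 * k\<^sup>2 - 1)) z\<^sub>0 \<gamma> \<epsilon> \<psi> \<psi>' z) \<longleftrightarrow>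
    is_solution c \<epsilon> \<gamma> \<psi> z \<and> on_level_set c d \<psi> z \<and>
    periodic_fun_simple \<psi> (real p) \<and> periodic_fun_simple z (real p)" (is "?L \<longleftrightarrow> ?R")
  proof
    assume ?L
    then obtain \<psi>' where o:
      "perturbed_pendulum.perturbed_orbit c (real p) (4 * c\<^sup>2 * (2 * k\<^sup>2 - 1)) z\<^sub>0 \<gamma> \<epsilon> \<psi> \<psi>' z" ..
    note o' = o[unfolded perturbed_pendulum.perturbed_orbit_def[OF assms(1)] level]
    have "deriv \<psi> = \<psi>'"
      using o' by (auto intro: DERIV_imp_deriv)
    thus ?R
      using o' unfolding is_solution_def on_level_set_def periodic_fun_simple_def
      by (auto simp: real_differentiable_def)
  next
    assume ?R
    thus ?L
      unfolding perturbed_pendulum.perturbed_orbit_def[OF assms(1)] level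
        is_solution_def on_level_set_def periodic_fun_simple_def
      by (intro exI[of _ "deriv \<psi>"]) (auto simp: DERIV_deriv_iff_real_differentiable)
  qed
  thus ?thesis
    by (auto simp: near_solutions_def leading_term_def dist_norm assms(2))
qed

theorem theorem9:
  fixes c k d \<alpha>\<^sub>0 :: real and \<gamma> :: "real \<Rightarrow> real" and p q :: nat
  assumes "c > 0" and "0 < k" and "k < 1"
    and "periodic_fun_simple \<gamma> 1" and "C2_fun \<gamma>"
    and "p > 0" and "q > 0" and "elliptic_K k = c * real p / (2 * real q)"
    and "d < - 8 * c\<^sup>2 * (1 - k\<^sup>2)"
    and "integral {0..real p} (\<lambda>t. \<gamma> (t + \<alpha>\<^sub>0) * jacobi_cn (2 * c * t) k) = 0"
    and "integral {0..real p} (\<lambda>t. deriv \<gamma> (t + \<alpha>\<^sub>0) * jacobi_cn (2 * c * t) k) \<noteq> 0"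
  shows "\<exists>C\<^sub>0>0. \<forall>C\<ge>C\<^sub>0. \<exists>\<delta>>0. \<forall>\<epsilon>. 0 < \<bar>\<epsilon>\<bar> \<and> \<bar>\<epsilon>\<bar> < \<delta> \<longrightarrow>
           (\<forall>s\<in>{1, -1}. \<exists>!w. w \<in> near_solutions k c d \<gamma> p \<alpha>\<^sub>0 \<epsilon> s (C * \<bar>\<epsilon>\<bar>)) \<and>
           card (\<Union>s\<in>{1, -1}. near_solutions k c d \<gamma> p \<alpha>\<^sub>0 \<epsilon> s (C * \<bar>\<epsilon>\<bar>)) = 2"
proof -
  define P where "P = real p"
  define \<phi> where "\<phi> t = 4 * c * k * jacobi_cn (2 * c * (t - \<alpha>\<^sub>0)) k" for t
  define \<zeta> where "\<zeta> = sqrt (- 4 * c\<^sup>2 * (1 - k\<^sup>2) - d / 2)"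
  have "P > 0"
    using assms by (simp add: P_def)
  interpret O: pendulum_orbit c P "4 * c\<^sup>2 * (2 * k\<^sup>2 - 1)" "\<lambda>t. psi_kc k c (t - \<alpha>\<^sub>0)" \<phi>
    unfolding \<phi>_def[abs_def] by (rule psi_kc_orbit[where q = q]) (use assms in \<open>auto simp: P_def\<close>)
  have pos: "- 4 * c\<^sup>2 * (1 - k\<^sup>2) - d / 2 > 0"
  proof -
    have "0 \<le> c\<^sup>2 * (1 - k\<^sup>2)"
      using assms(2,3) by (simp add: power_le_one)
    thus ?thesis using assms(9) by linarith
  qed
  hence \<zeta>: "\<zeta> > 0" "\<zeta>\<^sup>2 = - 4 * c\<^sup>2 * (1 - k\<^sup>2) - d / 2"
    by (auto simp: \<zeta>_def)
  note \<gamma> = C2_fun_derivative[OF assms(5)]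
  have \<gamma>_per: "\<gamma> (t + P) = \<gamma> t" for t
  proof -
    interpret periodic_fun_simple \<gamma> 1 by fact
    show ?thesis using plus_of_nat[of t p] by (simp add: P_def)
  qed
  \<comment> \<open>The orbit is centred at \<open>\<alpha>\<^sub>0\<close>, whereas the hypotheses
    shift \<gamma>; over a full period both integrals agree.\<close>
  have shift: "primitive (\<lambda>t. \<phi> t * f t) P = 4 * c * k * integral {0..P} (\<lambda>t. f (t + \<alpha>\<^sub>0) * jacobi_cn (2 * c * t) k)"
    if "continuous_on UNIV f" "\<And>t. f (t + P) = f t" for f
  proof -
    have "continuous_on UNIV (\<lambda>t. \<phi> t * f t)"
      by (intro continuous_intros O.continuous_orbit that)
    moreover from this have "continuous_on UNIV (\<lambda>t. \<phi> (t + \<alpha>\<^sub>0) * f (t + \<alpha>\<^sub>0))"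
      by (rule continuous_on_compose2) (auto intro!: continuous_intros)
    ultimately have "primitive (\<lambda>t. \<phi> t * f t) P = integral {0..P} (\<lambda>t. \<phi> (t + \<alpha>\<^sub>0) * f (t + \<alpha>\<^sub>0))"
      using primitive_periodic_shift[of "\<lambda>t. \<phi> t * f t" P \<alpha>\<^sub>0] that(2) O.orbit_periodic(1) \<open>P > 0\<close>
      by (simp add: primitive_eq_integral)
    also have "\<dots> = integral {0..P} (\<lambda>t. (4 * c * k) * (f (t + \<alpha>\<^sub>0) * jacobi_cn (2 * c * t) k))"
      by (simp add: \<phi>_def mult_ac)
    finally show ?thesis by simp
  qed
  have zero: "primitive (\<lambda>t. \<phi> t * \<gamma> t) P = 0"
    using shift[OF \<gamma>(2) \<gamma>_per] assms(10) by (simp add: P_def)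
  have simple: "primitive (\<lambda>t. O.\<phi>' t * \<gamma> t) P \<noteq> 0"
  proof -
    have c: "continuous_on UNIV (\<lambda>t. O.\<phi>' t * \<gamma> t)" "continuous_on UNIV (\<lambda>t. \<phi> t * deriv \<gamma> t)"
      by (intro continuous_intros O.continuous_orbit \<gamma>)+
    \<comment> \<open>Integration by parts without boundary terms, since
      \<open>\<phi> * \<gamma>\<close> is periodic.\<close>
    have "primitive (\<lambda>t. O.\<phi>' t * \<gamma> t + \<phi> t * deriv \<gamma> t) P = 0"
    proof (rule primitive_of_periodic_derivative)
      show "((\<lambda>t. \<phi> t * \<gamma> t) has_real_derivative O.\<phi>' t * \<gamma> t + \<phi> t * deriv \<gamma> t) (at t)" for t
        by (rule derivative_eq_intros refl O.orbit_derivatives \<gamma>)+ simp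
    qed (auto intro!: continuous_on_add c simp: O.orbit_periodic \<gamma>_per)
    moreover have "primitive (\<lambda>t. \<phi> t * deriv \<gamma> t) P \<noteq> 0"
      using shift[OF \<gamma>(3) derivative_periodic[of \<gamma> "deriv \<gamma>" P, OF \<gamma>(1) \<gamma>_per]] assms(1,2,11)
      by (simp add: P_def)
    ultimately show ?thesis
      by (simp add: primitive_add[OF c])
  qed
  have main: "\<exists>C\<^sub>0>0. \<forall>C\<ge>C\<^sub>0. \<exists>\<delta>>0. \<forall>\<epsilon>. 0 < \<bar>\<epsilon>\<bar> \<and> \<bar>\<epsilon>\<bar> < \<delta> \<longrightarrow>
      (\<exists>!w. w \<in> near_solutions k c d \<gamma> p \<alpha>\<^sub>0 \<epsilon> s (C * \<bar>\<epsilon>\<bar>))" if "s\<^sup>2 = 1" for s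
  proof -
    have pp: "perturbed_pendulum c P (4 * c\<^sup>2 * (2 * k\<^sup>2 - 1)) (\<lambda>t. psi_kc k c (t - \<alpha>\<^sub>0)) \<phi> (s * \<zeta>) \<gamma>"
      by unfold_locales (use that \<zeta> \<gamma> \<gamma>_per zero simple in auto)
    have "w \<in> near_solutions k c d \<gamma> p \<alpha>\<^sub>0 \<epsilon> s r \<longleftrightarrow> (case w of (\<psi>, z) \<Rightarrow>
        (\<exists>\<psi>'. perturbed_pendulum.perturbed_orbit c P (4 * c\<^sup>2 * (2 * k\<^sup>2 - 1)) (s * \<zeta>) \<gamma> \<epsilon> \<psi> \<psi>' z) \<and>
        (\<forall>t. norm (\<psi> t - psi_kc k c (t - \<alpha>\<^sub>0), z t - s * \<zeta>) \<le> r))" for w \<epsilon> r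
      using near_solutions_iff[OF pp[unfolded P_def \<phi>_def[abs_def]]] that \<zeta>(2)
      by (cases w) (simp add: \<zeta>_def P_def power_mult_distrib)
    thus ?thesis
      using perturbed_pendulum.unique_nearby_perturbed_orbit[OF pp] by simp
  qed
  have "\<exists>C\<^sub>0>0. \<forall>C\<ge>C\<^sub>0. \<exists>\<delta>>0. \<forall>\<epsilon>. 0 < \<bar>\<epsilon>\<bar> \<and> \<bar>\<epsilon>\<bar> < \<delta> \<longrightarrow>
      (\<exists>!w. w \<in> near_solutions k c d \<gamma> p \<alpha>\<^sub>0 \<epsilon> 1 (C * \<bar>\<epsilon>\<bar>))"
    "\<exists>C\<^sub>0>0. \<forall>C\<ge>C\<^sub>0. \<exists>\<delta>>0. \<forall>\<epsilon>. 0 < \<bar>\<epsilon>\<bar> \<and> \<bar>\<epsilon>\<bar> < \<delta> \<longrightarrow>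
      (\<exists>!w. w \<in> near_solutions k c d \<gamma> p \<alpha>\<^sub>0 \<epsilon> (-1) (C * \<bar>\<epsilon>\<bar>))"
    by (rule main; simp)+
  then obtain C1 C2 where C12: "C1 > 0" "C2 > 0"
    and C1: "\<And>C. C \<ge> C1 \<Longrightarrow> \<exists>\<delta>>0. \<forall>\<epsilon>. 0 < \<bar>\<epsilon>\<bar> \<and> \<bar>\<epsilon>\<bar> < \<delta> \<longrightarrow>
      (\<exists>!w. w \<in> near_solutions k c d \<gamma> p \<alpha>\<^sub>0 \<epsilon> 1 (C * \<bar>\<epsilon>\<bar>))"
    and C2: "\<And>C. C \<ge> C2 \<Longrightarrow> \<exists>\<delta>>0. \<forall>\<epsilon>. 0 < \<bar>\<epsilon>\<bar> \<and> \<bar>\<epsilon>\<bar> < \<delta> \<longrightarrow>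
      (\<exists>!w. w \<in> near_solutions k c d \<gamma> p \<alpha>\<^sub>0 \<epsilon> (-1) (C * \<bar>\<epsilon>\<bar>))"
    by blast
  show ?thesis
  proof (rule exI[of _ "max C1 C2"], intro conjI allI impI)
    fix C assume C: "C \<ge> max C1 C2"
    obtain \<delta>1 where \<delta>1: "\<delta>1 > 0" "\<And>\<epsilon>. 0 < \<bar>\<epsilon>\<bar> \<Longrightarrow> \<bar>\<epsilon>\<bar> < \<delta>1 \<Longrightarrow>
        \<exists>!w. w \<in> near_solutions k c d \<gamma> p \<alpha>\<^sub>0 \<epsilon> 1 (C * \<bar>\<epsilon>\<bar>)"
      using C1[of C] C by auto
    obtain \<delta>2 where \<delta>2: "\<delta>2 > 0" "\<And>\<epsilon>. 0 < \<bar>\<epsilon>\<bar> \<Longrightarrow> \<bar>\<epsilon>\<bar> < \<delta>2 \<Longrightarrow>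
        \<exists>!w. w \<in> near_solutions k c d \<gamma> p \<alpha>\<^sub>0 \<epsilon> (-1) (C * \<bar>\<epsilon>\<bar>)"
      using C2[of C] C by auto
    have "C > 0" using C C12 by simp
    \<comment> \<open>The last bound ensures \<open>C * \<bar>\<epsilon>\<bar> < \<zeta>\<close>, so
      no \<open>z\<close> is near both \<zeta> and \<open>- \<zeta>\<close> and the two solutions
      are distinct.\<close>
    define \<delta> where "\<delta> = min (min \<delta>1 \<delta>2) (\<zeta> / C)"
    show "\<exists>\<delta>>0. \<forall>\<epsilon>. 0 < \<bar>\<epsilon>\<bar> \<and> \<bar>\<epsilon>\<bar> < \<delta> \<longrightarrow>
      (\<forall>s\<in>{1, -1}. \<exists>!w. w \<in> near_solutions k c d \<gamma> p \<alpha>\<^sub>0 \<epsilon> s (C * \<bar>\<epsilon>\<bar>)) \<and>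
      card (\<Union>s\<in>{1, -1}. near_solutions k c d \<gamma> p \<alpha>\<^sub>0 \<epsilon> s (C * \<bar>\<epsilon>\<bar>)) = 2"
    proof (rule exI[of _ \<delta>], rule conjI, goal_cases)
      case 1
      show ?case using \<delta>1 \<delta>2 \<zeta> \<open>C > 0\<close> by (simp add: \<delta>_def)
    next
      case 2
      show ?case
      proof (intro allI impI)
        fix \<epsilon> assume "0 < \<bar>\<epsilon>\<bar> \<and> \<bar>\<epsilon>\<bar> < \<delta>"
        hence \<epsilon>: "0 < \<bar>\<epsilon>\<bar>" "\<bar>\<epsilon>\<bar> < \<delta>1" "\<bar>\<epsilon>\<bar> < \<delta>2" "\<bar>\<epsilon>\<bar> < \<zeta> / C"
          by (auto simp: \<delta>_def)
        let ?S = "\<lambda>s. near_solutions k c d \<gamma> p \<alpha>\<^sub>0 \<epsilon> s (C * \<bar>\<epsilon>\<bar>)"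
        have ex1: "\<exists>!w. w \<in> ?S 1" and ex2: "\<exists>!w. w \<in> ?S (-1)"
          using \<delta>1(2) \<delta>2(2) \<epsilon> by auto
        obtain w1 w2 where w: "?S 1 = {w1}" "?S (-1) = {w2}"
          using ex1 ex2 by (metis (no_types, lifting) insertI1 is_singletonI' is_singleton_def equals0D)
        have "w1 \<noteq> w2"
        proof
          assume "w1 = w2"
          obtain \<psi> z where "w1 = (\<psi>, z)" by (cases w1)
          with w \<open>w1 = w2\<close> have "(\<psi>, z) \<in> ?S 1" "(\<psi>, z) \<in> ?S (-1)" by auto
          hence "dist (\<psi> 0, z 0) (leading_term k c d \<alpha>\<^sub>0 1 0) \<le> C * \<bar>\<epsilon>\<bar>"
            "dist (\<psi> 0, z 0) (leading_term k c d \<alpha>\<^sub>0 (-1) 0) \<le> C * \<bar>\<epsilon>\<bar>"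
            by (auto simp: near_solutions_def)
          hence "dist (z 0) \<zeta> \<le> C * \<bar>\<epsilon>\<bar>" "dist (z 0) (- \<zeta>) \<le> C * \<bar>\<epsilon>\<bar>"
            using dist_snd_le[of "(\<psi> 0, z 0)" "leading_term k c d \<alpha>\<^sub>0 1 0"]
              dist_snd_le[of "(\<psi> 0, z 0)" "leading_term k c d \<alpha>\<^sub>0 (-1) 0"]
            by (auto simp: leading_term_def \<zeta>_def)
          moreover have "C * \<bar>\<epsilon>\<bar> < \<zeta>"
            using \<epsilon>(4) \<open>C > 0\<close> by (simp add: field_simps)
          ultimately show False
            by (auto simp: dist_real_def abs_le_iff)
        qed
        hence "card (\<Union>s\<in>{1, -1}. ?S s) = 2"
          by (simp add: w)
        with ex1 ex2 show "(\<forall>s\<in>{1, -1}. \<exists>!w. w \<in> ?S s) \<and> card (\<Union>s\<in>{1, -1}. ?S s) = 2"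
          by simp
      qed
    qed
  qed (use C12 in auto)
qed

end
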